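(* Let $M \ge 1$ and $n \ge 1$ be integers. Let $S$ be the graph (the symplectic lattice) whose vertex set is the set of points $(l_1,\dots,l_n) \in \{0,1,\dots,2M\}^n$ obtained from the weights $(m_1,\dots,m_n)$ of the irreducible representation of $\mathfrak{sp}(2n,\mathbb{C})$ with highest weight $(M,\dots,M)$ via $l_i = m_i + M$ (equivalently, the points of $\{0,\dots,2M\}^n$ with even coordinate sum), two vertices being adjacent iff their difference is a root of $\mathfrak{sp}(2n,\mathbb{C})$, i.e. one of $\pm 2e_i$ or $\pm e_i \pm e_j$ ($i \ne j$). Then for any two vertices $\lambda = (l_1,\dots,l_n)$ and $\lambda' = (l_1',\dots,l_n')$ of $S$, the graph distance between them is $$ d_S(\lambda,\lambda') = \sum_{i=1}^n \frac{|l_i - l_i'|}{2} .$$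
   Context: $e_1,\dots,e_n$ denotes the standard basis of $\mathbb{Z}^n$, and weights and roots of $\mathfrak{sp}(2n,\mathbb{C})$ are written in these coordinates (roots $\pm 2e_i$, $\pm e_i\pm e_j$). The graph distance is the number of edges in a shortest path in $S$. *)

theory Defs
  imports "Jordan_Normal_Form.Matrix" "Graph_Theory.Shortest_Path"
begin

section \<open>The Lie algebra \<open>sp(2n, \<complex>)\<close> and its roots\<close>

definition symplectic_form :: "nat \<Rightarrow> complex mat" where
  "symplectic_form n =
     four_block_mat (0\<^sub>m n n) (1\<^sub>m n) (- 1\<^sub>m n) (0\<^sub>m n n)"

definition sp :: "nat \<Rightarrow> complex mat set" where
  "sp n = {X \<in> carrier_mat (2 * n) (2 * n).
     transpose_mat X * symplectic_form n + symplectic_form n * X = 0\<^sub>m (2 * n) (2 * n)}"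

definition bracket :: "complex mat \<Rightarrow> complex mat \<Rightarrow> complex mat" where
  "bracket X Y = X * Y - Y * X"

text \<open>
  The diagonal Cartan subalgebra consists of the matrices
  \<open>diag(h\<^sub>1, \<dots>, h\<^sub>n, -h\<^sub>1, \<dots>, -h\<^sub>n)\<close>. An integer vector
  \<open>m = \<Sum>\<^sub>i m\<^sub>i e\<^sub>i\<close> stands for the linear functional sending this matrix to
  \<open>\<Sum>\<^sub>i m\<^sub>i h\<^sub>i\<close>.
\<close>

definition cartan :: "nat \<Rightarrow> complex vec \<Rightarrow> complex mat" where
  "cartan n h = mat_diag (2 * n) (\<lambda>i. if i < n then h $ i else - (h $ (i - n)))"

definition functional :: "nat \<Rightarrow> int vec \<Rightarrow> complex vec \<Rightarrow> complex" where
  "functional n m h = (\<Sum>i<n. of_int (m $ i) * h $ i)"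

definition root_space :: "nat \<Rightarrow> int vec \<Rightarrow> complex mat set" where
  "root_space n \<alpha> = {X \<in> sp n.
     \<forall>h \<in> carrier_vec n. bracket (cartan n h) X = functional n \<alpha> h \<cdot>\<^sub>m X}"

definition roots :: "nat \<Rightarrow> int vec set" where
  "roots n = {\<alpha> \<in> carrier_vec n. \<alpha> \<noteq> 0\<^sub>v n \<and> (\<exists>X \<in> root_space n \<alpha>. X \<noteq> 0\<^sub>m (2 * n) (2 * n))}"

text \<open>The positive system with simple roots
  \<open>e\<^sub>1 - e\<^sub>2, \<dots>, e\<^sub>n\<^sub>-\<^sub>1 - e\<^sub>n, 2e\<^sub>n\<close>.\<close>

definition positive_roots :: "nat \<Rightarrow> int vec set" where
  "positive_roots n =
     {2 \<cdot>\<^sub>v unit_vec n i | i. i < n}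
     \<union> {unit_vec n i + unit_vec n j | i j. i < j \<and> j < n}
     \<union> {unit_vec n i - unit_vec n j | i j. i < j \<and> j < n}"


section \<open>Finite-dimensional representations and their weights\<close>

locale sp_representation = vector_space scl
  for n :: nat
  and scl :: "complex \<Rightarrow> 'v::ab_group_add \<Rightarrow> 'v"
  and \<rho> :: "complex mat \<Rightarrow> 'v \<Rightarrow> 'v" +
  assumes finite_dim: "\<exists>B. finite B \<and> span B = UNIV"
  and rep_linear: "X \<in> sp n \<Longrightarrow> Vector_Spaces.linear scl scl (\<rho> X)"
  and rep_add: "X \<in> sp n \<Longrightarrow> Y \<in> sp n \<Longrightarrow> \<rho> (X + Y) v = \<rho> X v + \<rho> Y v"
  and rep_smult: "X \<in> sp n \<Longrightarrow> \<rho> (c \<cdot>\<^sub>m X) v = scl c (\<rho> X v)"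
  and rep_bracket: "X \<in> sp n \<Longrightarrow> Y \<in> sp n \<Longrightarrow>
        \<rho> (bracket X Y) v = \<rho> X (\<rho> Y v) - \<rho> Y (\<rho> X v)"
begin

definition irreducible_rep :: bool where
  "irreducible_rep \<longleftrightarrow> (\<exists>v::'v. v \<noteq> 0) \<and>
     (\<forall>W. subspace W \<and> (\<forall>X \<in> sp n. \<rho> X ` W \<subseteq> W) \<longrightarrow> W = {0} \<or> W = UNIV)"

definition weight_space :: "int vec \<Rightarrow> 'v set" where
  "weight_space m = {v. \<forall>h \<in> carrier_vec n. \<rho> (cartan n h) v = scl (functional n m h) v}"

definition weights :: "int vec set" where
  "weights = {m \<in> carrier_vec n. \<exists>v \<in> weight_space m. v \<noteq> 0}"

definition has_highest_weight :: "int vec \<Rightarrow> bool" where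
  "has_highest_weight m \<longleftrightarrow> m \<in> carrier_vec n \<and>
     (\<exists>v \<in> weight_space m. v \<noteq> 0 \<and>
        (\<forall>\<alpha> \<in> positive_roots n. \<forall>X \<in> root_space n \<alpha>. \<rho> X v = 0))"

end


section \<open>The symplectic lattice\<close>

definition lattice_points :: "nat \<Rightarrow> nat \<Rightarrow> int vec set" where
  "lattice_points M n =
     {l \<in> carrier_vec n. (\<forall>i<n. 0 \<le> l $ i \<and> l $ i \<le> 2 * int M) \<and> even (\<Sum>i<n. l $ i)}"

text \<open>The undirected graph is modelled as a symmetric digraph, every edge being
  represented by its two orientations.\<close>

definition symplectic_lattice :: "nat \<Rightarrow> nat \<Rightarrow> (int vec, int vec \<times> int vec) pre_digraph" where
  "symplectic_lattice M n =
     \<lparr> verts = lattice_points M n,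
       arcs = {(l, l'). l \<in> lattice_points M n \<and> l' \<in> lattice_points M n \<and> l - l' \<in> roots n},
       tail = fst, head = snd \<rparr>"

lemma wf_digraph_symplectic_lattice: "wf_digraph (symplectic_lattice M n)"
  by unfold_locales (auto simp: symplectic_lattice_def)

text \<open>With unit arc weights, \<^const>\<open>wf_digraph.\<mu>\<close> is the minimal number of edges of a walk
  between two vertices, and is infinite if there is no such walk.
  Its defining equation is available for well-formed digraphs.\<close>

definition graph_distance :: "('a, 'b) pre_digraph \<Rightarrow> 'a \<Rightarrow> 'a \<Rightarrow> ereal" where
  "graph_distance G u v = wf_digraph.\<mu> G (\<lambda>_. 1) u v"

end

theory Submission
  imports Defs
begin

text \<open>
  The highest weight \<open>(M, \<dots>, M)\<close> vanishes on the coroots of the Levi factor \<open>gl(n)\<close> of the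
  Siegel parabolic subalgebra, so by \<open>sl\<^sub>2\<close>-theory the highest weight vector spans a line stable under
  that parabolic, and the representation is generated from it by the operators of weight
  \<open>- e\<^sub>i - e\<^sub>j\<close>. Hence every weight has coordinates at most \<open>M\<close> and the right parity, and
  \<open>sl\<^sub>2\<close>-theory for the roots \<open>2e\<^sub>i\<close> gives the lower bound \<open>- M\<close>. Conversely, strings in the directions
  \<open>2e\<^sub>i\<close> reach all vertices of the cube, and from the vertices all points of the right parity are reached
  by subtracting roots that pair positively with the current weight.

  A root has \<open>l\<^sub>1\<close>-norm \<open>2\<close>, which bounds the graph distance from below. A difference of even
  \<open>l\<^sub>1\<close>-norm can always be shortened by \<open>2\<close>, either along a coordinate in which it is at least \<open>2\<close>
  or along two coordinates in which it is nonzero, without leaving the box.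
\<close>

section \<open>Root vectors of the symplectic Lie algebra\<close>

text \<open>
  The standard basis of the \<open>2n\<close>-dimensional space is indexed by \<open>p < 2n\<close>; \<open>opp n p\<close> is the index of
  the symplectic partner of the \<open>p\<close>-th basis vector, whose weight \<open>wt n p\<close> is \<open>e\<^sub>p\<close> for
  \<open>p < n\<close> and \<open>- e\<^sub>p\<^sub>-\<^sub>n\<close> otherwise. With this indexing, all root vectors and their brackets
  are treated by the same formulas.
\<close>

definition opp :: "nat \<Rightarrow> nat \<Rightarrow> nat" where
  "opp n p = (if p < n then p + n else p - n)"

definition eps :: "nat \<Rightarrow> nat \<Rightarrow> 'a::comm_ring_1" where
  "eps n p = (if p < n then 1 else - 1)"

text \<open>The \<open>p\<close>-th diagonal entry of \<open>cartan n h\<close>. On a weight it is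
  the coordinate in the signed direction \<open>wt n p\<close>, so bounds from above and below
  become a single family over \<open>p < 2 * n\<close>.\<close>

definition ext_coord :: "nat \<Rightarrow> 'a::comm_ring_1 vec \<Rightarrow> nat \<Rightarrow> 'a" where
  "ext_coord n h p = (if p < n then h $ p else - (h $ (p - n)))"

definition wt :: "nat \<Rightarrow> nat \<Rightarrow> 'a::comm_ring_1 vec" where
  "wt n p = (if p < n then unit_vec n p else - unit_vec n (p - n))"

definition omega :: "nat \<Rightarrow> nat \<Rightarrow> nat \<Rightarrow> complex" where
  "omega n p q = (if q = opp n p then eps n p else 0)"

text \<open>
  The map \<open>x \<mapsto> \<omega>(b\<^sub>q, x) b\<^sub>p + \<omega>(b\<^sub>p, x) b\<^sub>q\<close> on the standard basis \<open>b\<close>, from the identification of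
  the symplectic Lie algebra with the symmetric square of the standard representation. It has weight
  \<open>wt n p + wt n q\<close>, hence lies in the Cartan subalgebra iff \<open>q = opp n p\<close>.
\<close>

definition root_mat :: "nat \<Rightarrow> nat \<Rightarrow> nat \<Rightarrow> complex mat" where
  "root_mat n p q = mat (2 * n) (2 * n)
     (\<lambda>(r, c). (if r = p then omega n q c else 0) + (if r = q then omega n p c else 0))"

text \<open>The long root \<open>wt n p + wt n p\<close> has coroot \<open>wt n p\<close>; a short
  root is its own coroot in the standard inner product.\<close>

definition coroot :: "nat \<Rightarrow> nat \<Rightarrow> nat \<Rightarrow> complex vec" where
  "coroot n p q = (if p = q then wt n p else wt n p + wt n q)"

text \<open>Since \<open>root_mat\<close> is not normalised, the bracket of two opposite root
  matrices is only a nonzero multiple of the coroot; this is the factor.\<close>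

definition coroot_coeff :: "nat \<Rightarrow> nat \<Rightarrow> nat \<Rightarrow> complex" where
  "coroot_coeff n p q = (if p = q then - 4 else - (eps n p * eps n q))"

lemma opp_less [simp]: "p < 2 * n \<Longrightarrow> opp n p < 2 * n"
  by (auto simp: opp_def)

lemma opp_opp [simp]: "p < 2 * n \<Longrightarrow> opp n (opp n p) = p"
  by (auto simp: opp_def)

lemma opp_neq [simp]: "p < 2 * n \<Longrightarrow> opp n p \<noteq> p" "p < 2 * n \<Longrightarrow> p \<noteq> opp n p"
  by (auto simp: opp_def)

lemma opp_eq_iff: "p < 2 * n \<Longrightarrow> q < 2 * n \<Longrightarrow> opp n p = q \<longleftrightarrow> p = opp n q"
  by auto

lemma opp_eq_opp_iff [simp]: "p < 2 * n \<Longrightarrow> q < 2 * n \<Longrightarrow> opp n p = opp n q \<longleftrightarrow> p = q"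
  using opp_opp by metis

lemma eps_opp [simp]: "p < 2 * n \<Longrightarrow> eps n (opp n p) = - eps n p"
  by (auto simp: opp_def eps_def)

lemma eps_mult_self [simp]: "eps n p * eps n p = 1" "eps n p * (eps n p * x) = x"
  by (auto simp: eps_def)

lemma eps_neq_0 [simp]: "eps n p \<noteq> (0::'a::{comm_ring_1})"
  by (auto simp: eps_def)

lemma wt_carrier [simp]: "wt n p \<in> carrier_vec n"
  by (auto simp: wt_def)

lemma dim_wt [simp]: "dim_vec (wt n p) = n"
  by (auto simp: wt_def)

lemma ext_coord_opp [simp]: "p < 2 * n \<Longrightarrow> ext_coord n h (opp n p) = - ext_coord n h p"
  by (auto simp: ext_coord_def opp_def)

lemma ext_coord_add [simp]:
  "u \<in> carrier_vec n \<Longrightarrow> v \<in> carrier_vec n \<Longrightarrow> p < 2 * n \<Longrightarrow>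
   ext_coord n (u + v) p = ext_coord n u p + ext_coord n v p"
  by (auto simp: ext_coord_def)

lemma ext_coord_smult [simp]:
  "u \<in> carrier_vec n \<Longrightarrow> p < 2 * n \<Longrightarrow> ext_coord n (c \<cdot>\<^sub>v u) p = c * ext_coord n u p"
  by (auto simp: ext_coord_def)

lemma ext_coord_wt:
  "p < 2 * n \<Longrightarrow> q < 2 * n \<Longrightarrow>
   ext_coord n (wt n p) q = (if q = p then 1 else if q = opp n p then - 1 else 0)"
  by (auto simp: ext_coord_def wt_def opp_def)

lemma wt_opp: "p < 2 * n \<Longrightarrow> wt n (opp n p) = - wt n p"
  by (auto simp: opp_def wt_def)

lemma wt_add_wt_opp: "p < 2 * n \<Longrightarrow> wt n p + wt n (opp n p) = 0\<^sub>v n"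
  by (auto simp: wt_opp)

lemma coroot_carrier [simp]: "coroot n p q \<in> carrier_vec n"
  by (auto simp: coroot_def)

lemma coroot_coeff_neq_0 [simp]: "coroot_coeff n p q \<noteq> 0"
  by (auto simp: coroot_coeff_def)

lemma cartan_carrier [simp]: "cartan n h \<in> carrier_mat (2 * n) (2 * n)"
  by (simp add: cartan_def)

lemma dim_cartan [simp]: "dim_row (cartan n h) = 2 * n" "dim_col (cartan n h) = 2 * n"
  by (simp_all add: cartan_def mat_diag_def)

lemma cartan_eq: "cartan n h = mat_diag (2 * n) (ext_coord n h)"
  by (simp add: cartan_def ext_coord_def[abs_def])

lemma functional_wt:
  assumes "p < 2 * n"
  shows "functional n (wt n p) h = ext_coord n h p"
proof (cases "p < n")
  case True
  then have "functional n (wt n p) h = (\<Sum>i<n. if i = p then h $ i else 0)"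
    unfolding functional_def by (intro sum.cong) (auto simp: wt_def)
  then show ?thesis using True by (simp add: ext_coord_def)
next
  case False
  then have "functional n (wt n p) h = (\<Sum>i<n. if i = p - n then - (h $ i) else 0)"
    unfolding functional_def using assms by (intro sum.cong) (auto simp: wt_def)
  then show ?thesis using False assms by (simp add: ext_coord_def)
qed

lemma functional_wt_right:
  assumes "p < 2 * n"
  shows "functional n m (wt n p) = of_int (ext_coord n m p)"
proof (cases "p < n")
  case True
  then have "functional n m (wt n p) = (\<Sum>i<n. if i = p then of_int (m $ i) else 0)"
    unfolding functional_def by (intro sum.cong) (auto simp: wt_def)
  then show ?thesis using True by (simp add: ext_coord_def)
next
  case False
  then have "functional n m (wt n p) = (\<Sum>i<n. if i = p - n then - of_int (m $ i) else 0)"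
    unfolding functional_def using assms by (intro sum.cong) (auto simp: wt_def)
  then show ?thesis using False assms by (simp add: ext_coord_def)
qed

lemma functional_add:
  "m \<in> carrier_vec n \<Longrightarrow> m' \<in> carrier_vec n \<Longrightarrow>
   functional n (m + m') h = functional n m h + functional n m' h"
  by (simp add: functional_def sum.distrib[symmetric] algebra_simps)

lemma functional_add_right:
  "h \<in> carrier_vec n \<Longrightarrow> h' \<in> carrier_vec n \<Longrightarrow>
   functional n m (h + h') = functional n m h + functional n m h'"
  by (simp add: functional_def sum.distrib[symmetric] algebra_simps)

lemma functional_inj:
  assumes "m \<in> carrier_vec n" "m' \<in> carrier_vec n"
    and eq: "\<And>h. h \<in> carrier_vec n \<Longrightarrow> functional n m h = functional n m' h"
  shows "m = m'"
proof (rule eq_vecI)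
  fix i assume "i < dim_vec m'"
  then have i: "i < n" using assms by auto
  show "m $ i = m' $ i"
    using eq[of "wt n i"] i by (simp add: functional_wt_right ext_coord_def)
qed (use assms in auto)

section \<open>The symplectic condition on matrix entries\<close>

lemma symplectic_form_carrier [simp]: "symplectic_form n \<in> carrier_mat (2 * n) (2 * n)"
  unfolding symplectic_form_def by (metis four_block_carrier_mat mult_2 zero_carrier_mat)

lemma dim_symplectic_form [simp]:
  "dim_row (symplectic_form n) = 2 * n" "dim_col (symplectic_form n) = 2 * n"
  using carrier_matD[OF symplectic_form_carrier] by auto

lemma symplectic_form_index:
  "i < 2 * n \<Longrightarrow> j < 2 * n \<Longrightarrow> symplectic_form n $$ (i, j) = omega n i j"
  by (auto simp: symplectic_form_def omega_def opp_def eps_def)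

lemma root_mat_carrier [simp]: "root_mat n p q \<in> carrier_mat (2 * n) (2 * n)"
  by (simp add: root_mat_def)

lemma dim_root_mat [simp]:
  "dim_row (root_mat n p q) = 2 * n" "dim_col (root_mat n p q) = 2 * n"
  by (simp_all add: root_mat_def)

lemma root_mat_index:
  "r < 2 * n \<Longrightarrow> c < 2 * n \<Longrightarrow> root_mat n p q $$ (r, c) =
     (if r = p then omega n q c else 0) + (if r = q then omega n p c else 0)"
  by (simp add: root_mat_def)

lemma root_mat_commute: "root_mat n p q = root_mat n q p"
  by (intro eq_matI) (auto simp: root_mat_def)

lemma sum_omega:
  assumes "i < 2 * n"
  shows "(\<Sum>k<2*n. f k * omega n k i) = f (opp n i) * - eps n i"
    and "(\<Sum>k<2*n. omega n i k * f k) = eps n i * f (opp n i)"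
proof -
  have "(\<Sum>k<2*n. f k * omega n k i) = (\<Sum>k<2*n. if k = opp n i then f k * eps n k else 0)"
    using assms by (intro sum.cong) (auto simp: omega_def)
  also have "\<dots> = f (opp n i) * - eps n i"
    using assms by (subst sum.delta) auto
  finally show "(\<Sum>k<2*n. f k * omega n k i) = f (opp n i) * - eps n i" .
  have "(\<Sum>k<2*n. omega n i k * f k) = (\<Sum>k<2*n. if k = opp n i then eps n i * f k else 0)"
    by (intro sum.cong) (auto simp: omega_def)
  then show "(\<Sum>k<2*n. omega n i k * f k) = eps n i * f (opp n i)"
    using assms by simp
qed

text \<open>By \<open>sum_omega\<close> the condition says that \<open>X * symplectic_form n\<close>
  is a symmetric matrix. This is the symmetric-square description of the algebra.\<close>

lemma sp_iff:
  "X \<in> sp n \<longleftrightarrow> X \<in> carrier_mat (2 * n) (2 * n) \<and>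
     (\<forall>a<2*n. \<forall>b<2*n. X $$ (a, opp n b) * eps n b = X $$ (b, opp n a) * eps n a)"
proof (cases "X \<in> carrier_mat (2 * n) (2 * n)")
  case True
  define Z where "Z = transpose_mat X * symplectic_form n + symplectic_form n * X"
  have Z: "Z \<in> carrier_mat (2 * n) (2 * n)" using True unfolding Z_def by (intro add_carrier_mat mult_carrier_mat) auto
  have ent: "Z $$ (i, j) = eps n i * X $$ (opp n i, j) - eps n j * X $$ (opp n j, i)"
    if i: "i < 2 * n" and j: "j < 2 * n" for i j
  proof -
    have "Z $$ (i, j) = (\<Sum>k<2*n. X $$ (k, i) * omega n k j) + (\<Sum>k<2*n. omega n i k * X $$ (k, j))"
      unfolding Z_def using True i j
      by (simp add: scalar_prod_def symplectic_form_index atLeast0LessThan)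
    then show ?thesis using i j by (simp add: sum_omega)
  qed
  have "X \<in> sp n \<longleftrightarrow> Z = 0\<^sub>m (2 * n) (2 * n)"
    using True by (simp add: sp_def Z_def)
  also have "\<dots> \<longleftrightarrow> (\<forall>i<2*n. \<forall>j<2*n. Z $$ (i, j) = 0)"
    using Z by (auto intro!: eq_matI)
  also have "\<dots> \<longleftrightarrow> (\<forall>i<2*n. \<forall>j<2*n. eps n i * X $$ (opp n i, j) = eps n j * X $$ (opp n j, i))"
    by (simp add: ent)
  also have "\<dots> \<longleftrightarrow> (\<forall>a<2*n. \<forall>b<2*n. X $$ (a, opp n b) * eps n b = X $$ (b, opp n a) * eps n a)"
  proof (intro iffI allI impI)
    fix a b assume *: "\<forall>i<2*n. \<forall>j<2*n. eps n i * X $$ (opp n i, j) = eps n j * X $$ (opp n j, i)"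
      and ab: "a < 2 * n" "b < 2 * n"
    have "- eps n a * X $$ (a, opp n b) = - eps n b * X $$ (b, opp n a)"
      using *[rule_format, of "opp n a" "opp n b"] ab by simp
    then have "eps n a * eps n b * (eps n a * X $$ (a, opp n b)) = eps n a * eps n b * (eps n b * X $$ (b, opp n a))"
      by simp
    then show "X $$ (a, opp n b) * eps n b = X $$ (b, opp n a) * eps n a"
      by (simp add: algebra_simps)
  next
    fix i j assume *: "\<forall>a<2*n. \<forall>b<2*n. X $$ (a, opp n b) * eps n b = X $$ (b, opp n a) * eps n a"
      and ij: "i < 2 * n" "j < 2 * n"
    have "X $$ (opp n i, j) * - eps n j = X $$ (opp n j, i) * - eps n i"
      using *[rule_format, of "opp n i" "opp n j"] ij by simp
    then have "eps n i * eps n j * (X $$ (opp n i, j) * - eps n j) = eps n i * eps n j * (X $$ (opp n j, i) * - eps n i)"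
      by simp
    then show "eps n i * X $$ (opp n i, j) = eps n j * X $$ (opp n j, i)"
      by (simp add: algebra_simps)
  qed
  finally show ?thesis using True by simp
qed (auto simp: sp_def)

lemma sp_carrier: "X \<in> sp n \<Longrightarrow> X \<in> carrier_mat (2 * n) (2 * n)"
  by (simp add: sp_def)

lemma root_mat_sp [simp]: "p < 2 * n \<Longrightarrow> q < 2 * n \<Longrightarrow> root_mat n p q \<in> sp n"
  by (auto simp: sp_iff root_mat_index omega_def)

lemma cartan_sp [simp]: "cartan n h \<in> sp n"
  unfolding sp_iff by (auto simp: cartan_eq mat_diag_def opp_eq_iff)

lemma add_sp [simp]: "X \<in> sp n \<Longrightarrow> Y \<in> sp n \<Longrightarrow> X + Y \<in> sp n"
  by (auto simp: sp_iff distrib_right)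

lemma smult_sp [simp]: "X \<in> sp n \<Longrightarrow> c \<cdot>\<^sub>m X \<in> sp n"
  by (auto simp: sp_iff mult.assoc)

lemma zero_sp [simp]: "0\<^sub>m (2 * n) (2 * n) \<in> sp n"
  by (auto simp: sp_iff)

text \<open>Moving \<open>symplectic_form n\<close> across one transposed factor costs a sign, so
  across two it reverses their order without a sign, and the commutator changes sign as
  required.\<close>

lemma bracket_sp [simp]:
  assumes X: "X \<in> sp n" and Y: "Y \<in> sp n"
  shows "bracket X Y \<in> sp n"
proof -
  let ?J = "symplectic_form n"
  let ?C = "carrier_mat (2 * n) (2 * n)"
  note c = sp_carrier[OF X] sp_carrier[OF Y] symplectic_form_carrier[of n]
  have swap: "transpose_mat A * ?J = - (?J * A)" if "A \<in> sp n" for A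
  proof -
    have A: "A \<in> ?C" using that by (rule sp_carrier)
    have e: "transpose_mat A * ?J + ?J * A = 0\<^sub>m (2 * n) (2 * n)" using that by (simp add: sp_def)
    show ?thesis
    proof (rule eq_matI)
      fix i j assume ij: "i < dim_row (- (?J * A))" "j < dim_col (- (?J * A))"
      then have "(transpose_mat A * ?J + ?J * A) $$ (i, j) = 0" unfolding e using A c by simp
      then show "(transpose_mat A * ?J) $$ (i, j) = (- (?J * A)) $$ (i, j)"
        using ij A by (simp add: eq_neg_iff_add_eq_0 del: index_mult_mat(1))
    qed (use A c in auto)
  qed
  have prod: "transpose_mat (A * B) * ?J = ?J * (B * A)" if "A \<in> sp n" "B \<in> sp n" for A B
  proof -
    have A: "A \<in> ?C" and B: "B \<in> ?C" using that sp_carrier by auto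
    have "transpose_mat (A * B) * ?J = transpose_mat B * (transpose_mat A * ?J)"
      using A B c by (simp add: transpose_mult[OF A B] assoc_mult_mat[of _ "2*n" "2*n" _ "2*n" _ "2*n"])
    also have "\<dots> = - (transpose_mat B * ?J) * A"
      using A B c by (simp add: swap[OF that(1)] assoc_mult_mat[of _ "2*n" "2*n" _ "2*n" _ "2*n", symmetric])
    also have "\<dots> = ?J * B * A" using A B c
      by (simp add: swap[OF that(2)])
    also have "\<dots> = ?J * (B * A)" using A B c by (simp add: assoc_mult_mat[of _ "2*n" "2*n" _ "2*n" _ "2*n"])
    finally show ?thesis .
  qed
  have XY: "X * Y \<in> ?C" "Y * X \<in> ?C" using c by auto
  have "transpose_mat (bracket X Y) * ?J + ?J * bracket X Y
      = (transpose_mat (X * Y) - transpose_mat (Y * X)) * ?J + ?J * (X * Y - Y * X)"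
    unfolding bracket_def using XY by (simp add: transpose_minus)
  also have "\<dots> = (?J * (Y * X) - ?J * (X * Y)) + (?J * (X * Y) - ?J * (Y * X))"
  proof -
    have T: "transpose_mat (X * Y) \<in> ?C" "transpose_mat (Y * X) \<in> ?C" using XY by auto
    show ?thesis
      unfolding minus_mult_distrib_mat[OF T c(3)] mult_minus_distrib_mat[OF c(3) XY] prod[OF X Y] prod[OF Y X] ..
  qed
  also have "\<dots> = 0\<^sub>m (2 * n) (2 * n)"
    using XY c by (intro eq_matI) auto
  finally show ?thesis using minus_carrier_mat[OF XY(2)] by (simp add: sp_def bracket_def)
qed

section \<open>Brackets of root matrices and the root system\<close>

lemma bracket_cartan_index:
  assumes X: "X \<in> carrier_mat (2 * n) (2 * n)" and "r < 2 * n" "c < 2 * n"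
  shows "bracket (cartan n h) X $$ (r, c) = (ext_coord n h r - ext_coord n h c) * X $$ (r, c)"
  using assms carrier_matD[OF X]
  by (simp add: bracket_def cartan_eq mat_diag_mult_left[OF X] mat_diag_mult_right[OF X] left_diff_distrib)

lemma bracket_cartan_root_mat:
  assumes pq: "p < 2 * n" "q < 2 * n"
  shows "bracket (cartan n h) (root_mat n p q) = (ext_coord n h p + ext_coord n h q) \<cdot>\<^sub>m root_mat n p q"
proof (rule eq_matI, goal_cases)
  case (1 r c)
  then have "r < 2 * n" "c < 2 * n" by (simp_all add: root_mat_def)
  then show ?case using pq
    by (auto simp: bracket_cartan_index root_mat_index omega_def)
qed (simp_all add: bracket_def)

lemma root_mat_opp:
  assumes "p < 2 * n"
  shows "root_mat n p (opp n p) = (- eps n p) \<cdot>\<^sub>m cartan n (wt n p)"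
proof (rule eq_matI, goal_cases)
  case (1 r c)
  then have "r < 2 * n" "c < 2 * n" by simp_all
  then show ?case using \<open>p < 2 * n\<close>
    by (auto simp: root_mat_index omega_def cartan_eq mat_diag_def ext_coord_wt)
qed simp_all

text \<open>Up to scaling, the two opposite root matrices and the coroot thus form an sl2-triple,
  the input of \<open>sl2_string\<close>.\<close>

lemma bracket_root_mat_opp:
  assumes p: "p < 2 * n" and q: "q < 2 * n" and pq: "q \<noteq> opp n p"
  shows "bracket (root_mat n p q) (root_mat n (opp n p) (opp n q)) = coroot_coeff n p q \<cdot>\<^sub>m cartan n (coroot n p q)"
proof (rule eq_matI, goal_cases)
  case (1 r c)
  then have rc: "r < 2 * n" "c < 2 * n" by (simp_all add: cartan_eq mat_diag_def)
  have prod: "(root_mat n a b * root_mat n a' b') $$ (r, c) =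
      (if r = a then omega n b a' * omega n b' c + omega n b b' * omega n a' c else 0) +
      (if r = b then omega n a a' * omega n b' c + omega n a b' * omega n a' c else 0)"
    if "a < 2 * n" "b < 2 * n" "a' < 2 * n" "b' < 2 * n" for a b a' b'
  proof -
    \<comment> \<open>Only the rows \<open>a'\<close> and \<open>b'\<close> of the second factor are
      nonzero, so the sum over \<open>k\<close> collapses.\<close>
    have A: "(\<Sum>k<2*n. omega n x k * ((if k = a' then omega n b' c else 0) + (if k = b' then omega n a' c else 0)))
       = omega n x a' * omega n b' c + omega n x b' * omega n a' c" for x
    proof -
      have "(\<Sum>k<2*n. omega n x k * ((if k = a' then omega n b' c else 0) + (if k = b' then omega n a' c else 0)))
        = (\<Sum>k<2*n. (if k = a' then omega n x k * omega n b' c else 0)) + (\<Sum>k<2*n. if k = b' then omega n x k * omega n a' c else 0)"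
        unfolding sum.distrib[symmetric] by (intro sum.cong) auto
      then show ?thesis using that by simp
    qed
    have "(root_mat n a b * root_mat n a' b') $$ (r, c) = 
       (\<Sum>k<2*n. ((if r = a then omega n b k else 0) + (if r = b then omega n a k else 0)) *
          ((if k = a' then omega n b' c else 0) + (if k = b' then omega n a' c else 0)))"
      using rc
      by (simp add: scalar_prod_def root_mat_index atLeast0LessThan)
    also have "\<dots> = (if r = a then (\<Sum>k<2*n. omega n b k * ((if k = a' then omega n b' c else 0) + (if k = b' then omega n a' c else 0))) else 0)
      + (if r = b then (\<Sum>k<2*n. omega n a k * ((if k = a' then omega n b' c else 0) + (if k = b' then omega n a' c else 0))) else 0)"
      by (simp add: distrib_right sum.distrib)
    finally show ?thesis unfolding A .
  qed
  have "bracket (root_mat n p q) (root_mat n (opp n p) (opp n q)) $$ (r, c) =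
     (root_mat n p q * root_mat n (opp n p) (opp n q)) $$ (r, c) - (root_mat n (opp n p) (opp n q) * root_mat n p q) $$ (r, c)"
    using rc by (simp add: bracket_def del: index_mult_mat(1))
  also have "\<dots> = (if r = c then coroot_coeff n p q * ext_coord n (coroot n p q) c else 0)"
    unfolding prod[OF p q opp_less[OF p] opp_less[OF q]] prod[OF opp_less[OF p] opp_less[OF q] p q]
    using p q pq rc by (auto simp: omega_def coroot_coeff_def coroot_def ext_coord_wt)
  finally show ?case using rc by (simp add: cartan_eq mat_diag_def)
qed (simp_all add: bracket_def cartan_eq mat_diag_def root_mat_def)

lemma root_mat_root_space:
  assumes "p < 2 * n" "q < 2 * n"
  shows "root_mat n p q \<in> root_space n (wt n p + wt n q)"
  using assms by (auto simp: root_space_def bracket_cartan_root_mat functional_add functional_wt)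

lemma root_mat_neq_0:
  assumes "p < 2 * n" "q < 2 * n"
  shows "root_mat n p q \<noteq> 0\<^sub>m (2 * n) (2 * n)"
proof
  assume "root_mat n p q = 0\<^sub>m (2 * n) (2 * n)"
  then have "root_mat n p q $$ (p, opp n q) = 0" using assms by simp
  then show False using assms by (auto simp: root_mat_index omega_def split: if_splits)
qed

text \<open>The Cartan subalgebra scales the entry \<open>(r, c)\<close> of a matrix by a functional
  depending only on \<open>r\<close> and \<open>c\<close>, so one nonzero entry of a root vector
  determines its root. The excluded case \<open>q = opp n p\<close> is the zero weight.\<close>

lemma roots_eq_wt:
  "roots n = {wt n p + wt n q | p q. p < 2 * n \<and> q < 2 * n \<and> q \<noteq> opp n p}" (is "_ = ?R")
proof (intro Set.set_eqI iffI)
  fix \<alpha> assume "\<alpha> \<in> roots n"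
  then obtain X where \<alpha>: "\<alpha> \<in> carrier_vec n" "\<alpha> \<noteq> 0\<^sub>v n" and X: "X \<in> root_space n \<alpha>" "X \<noteq> 0\<^sub>m (2 * n) (2 * n)"
    by (auto simp: roots_def)
  have Xc: "X \<in> carrier_mat (2 * n) (2 * n)" using X by (auto simp: root_space_def sp_def)
  then obtain r c where rc: "r < 2 * n" "c < 2 * n" "X $$ (r, c) \<noteq> 0"
    using X(2) by (metis eq_matI carrier_matD index_zero_mat)
  have "functional n \<alpha> h = functional n (wt n r + wt n (opp n c)) h" if h: "h \<in> carrier_vec n" for h
  proof -
    have "bracket (cartan n h) X = functional n \<alpha> h \<cdot>\<^sub>m X" using X h by (auto simp: root_space_def)
    then have "(ext_coord n h r - ext_coord n h c) * X $$ (r, c) = functional n \<alpha> h * X $$ (r, c)"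
      using bracket_cartan_index[OF Xc rc(1,2), of h] rc Xc by simp
    then show ?thesis using rc by (simp add: functional_add functional_wt)
  qed
  then have *: "\<alpha> = wt n r + wt n (opp n c)" using \<alpha> by (intro functional_inj) auto
  moreover have "opp n c \<noteq> opp n r" using * \<alpha>(2) rc by (auto simp: wt_add_wt_opp)
  ultimately show "\<alpha> \<in> ?R" using rc opp_less[OF rc(2)] by blast
next
  fix \<alpha> assume "\<alpha> \<in> ?R"
  then obtain p q where pq: "p < 2 * n" "q < 2 * n" "q \<noteq> opp n p" "\<alpha> = wt n p + wt n q" by auto
  have "\<alpha> \<noteq> 0\<^sub>v n"
  proof
    assume "\<alpha> = 0\<^sub>v n"
    \<comment> \<open>In direction \<open>p\<close> the coordinate of \<open>wt n p + wt n q\<close>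
      is 1 or 2, because \<open>q\<close> is not \<open>opp n p\<close>.\<close>
    then have "ext_coord n \<alpha> p = 0" using pq by (simp add: ext_coord_def)
    then show False using pq by (auto simp: ext_coord_wt opp_eq_iff split: if_splits)
  qed
  then show "\<alpha> \<in> roots n"
    using pq root_mat_root_space[of p n q] root_mat_neq_0[of p n q] by (auto simp: roots_def)
qed

text \<open>Each index is some \<open>i < n\<close> or the \<open>opp\<close> of one, which gives
  four sign patterns. Equal indices yield the long roots if the signs agree and zero
  otherwise.\<close>

lemma roots_eq:
  "roots n =
     {2 \<cdot>\<^sub>v unit_vec n i | i. i < n}
     \<union> {- (2 \<cdot>\<^sub>v unit_vec n i) | i. i < n}
     \<union> {unit_vec n i + unit_vec n j | i j. i < n \<and> j < n \<and> i \<noteq> j}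
     \<union> {unit_vec n i - unit_vec n j | i j. i < n \<and> j < n \<and> i \<noteq> j}
     \<union> {- unit_vec n i + unit_vec n j | i j. i < n \<and> j < n \<and> i \<noteq> j}
     \<union> {- unit_vec n i - unit_vec n j | i j. i < n \<and> j < n \<and> i \<noteq> j}" (is "_ = ?R")
proof -
  have dbl: "2 \<cdot>\<^sub>v v = v + v" if "v \<in> carrier_vec n" for v :: "int vec"
    using that by auto
  have mm: "- (u + v) = - u + - v" "u - v = u + - v" if "u \<in> carrier_vec n" "v \<in> carrier_vec n" for u v :: "int vec"
    using that by auto
  have R: "?R = {unit_vec n i + unit_vec n j | i j. i < n \<and> j < n}
    \<union> {- unit_vec n i + - unit_vec n j | i j. i < n \<and> j < n}
    \<union> {unit_vec n i + - unit_vec n j | i j. i < n \<and> j < n \<and> i \<noteq> j}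
     \<union> {- unit_vec n i + unit_vec n j | i j. i < n \<and> j < n \<and> i \<noteq> j}"
  proof -
    have *: "{f i i | i. i < n} \<union> {f i j | i j. i < n \<and> j < n \<and> i \<noteq> j} = {f i j | i j. i < n \<and> j < n}"
      for f :: "nat \<Rightarrow> nat \<Rightarrow> int vec" by blast
    show ?thesis
      unfolding *[symmetric] by (simp add: dbl mm cong: conj_cong) blast
  qed
  have "roots n = {wt n p + wt n q | p q. p < n \<and> q < n} \<union> {wt n (opp n p) + wt n (opp n q) | p q. p < n \<and> q < n}
     \<union> {wt n p + wt n (opp n q) | p q. p < n \<and> q < n \<and> p \<noteq> q} \<union> {wt n (opp n p) + wt n q | p q. p < n \<and> q < n \<and> p \<noteq> q}" (is "_ = ?S")
  proof (intro Set.set_eqI iffI)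
    fix \<alpha> :: "int vec" assume "\<alpha> \<in> roots n"
    then obtain p q where pq: "p < 2 * n" "q < 2 * n" "q \<noteq> opp n p" "\<alpha> = wt n p + wt n q"
      unfolding roots_eq_wt by blast
    have ex: "\<exists>j<n. i = opp n j" if "i < 2 * n" "\<not> i < n" for i
      using that by (intro exI[of _ "opp n i"]) (auto simp: opp_def)
    show "\<alpha> \<in> ?S"
    proof (cases "p < n")
      case True
      show ?thesis
      proof (cases "q < n")
        case False
        then obtain j where j: "j < n" "q = opp n j" using ex pq by blast
        then have "p \<noteq> j" using pq by auto
        with True j have "\<exists>p q. \<alpha> = wt n p + wt n (opp n q) \<and> p < n \<and> q < n \<and> p \<noteq> q"
          using pq(4) by blast
        then show ?thesis by blast
      qed (use pq(4) True in blast)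
    next
      case False
      then obtain i where i: "i < n" "p = opp n i" using ex pq by blast
      show ?thesis
      proof (cases "q < n")
        case False
        then obtain j where "j < n" "q = opp n j" using ex pq by blast
        then show ?thesis using pq i by blast
      next
        case True
        have "i \<noteq> q" using pq i by auto
        with True have "\<exists>p q. \<alpha> = wt n (opp n p) + wt n q \<and> p < n \<and> q < n \<and> p \<noteq> q"
          using pq(4) i by blast
        then show ?thesis by blast
      qed
    qed
  next
    fix \<alpha> :: "int vec" assume "\<alpha> \<in> ?S"
    then obtain p q where pq: "p < n" "q < n" and
      "\<alpha> = wt n p + wt n q \<or> \<alpha> = wt n (opp n p) + wt n (opp n q) \<or>
       \<alpha> = wt n p + wt n (opp n q) \<and> p \<noteq> q \<or> \<alpha> = wt n (opp n p) + wt n q \<and> p \<noteq> q"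
      by blast
    moreover have "q \<noteq> opp n p" "p \<noteq> opp n q" using pq by (auto simp: opp_def)
    moreover have "opp n p < 2 * n" "opp n q < 2 * n" "p < 2 * n" "q < 2 * n" "opp n (opp n p) = p"
      "opp n q = opp n p \<longleftrightarrow> q = p" using pq by auto
    ultimately show "\<alpha> \<in> roots n" unfolding roots_eq_wt mem_Collect_eq by metis
  qed
  also have "\<dots> = ?R"
  proof -
    have wt: "wt n i = unit_vec n i" "wt n (opp n i) = - unit_vec n i" if "i < n" for i
      using that by (auto simp: wt_def opp_def)
    show ?thesis
      unfolding R by (intro arg_cong2[of _ _ _ _ "(\<union>)"] Collect_cong ex_cong1) (auto simp: wt)
  qed
  finally show ?thesis .
qed

text \<open>The root matrices span the algebra, so linear statements need checking only on
  them.\<close>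

lemma sp_induct [consumes 1, case_names zero root_mat add smult]:
  assumes X: "X \<in> sp n"
    and zero: "P (0\<^sub>m (2 * n) (2 * n))"
    and root_mat: "\<And>p q. p < 2 * n \<Longrightarrow> q < 2 * n \<Longrightarrow> P (root_mat n p q)"
    and add: "\<And>X Y. X \<in> sp n \<Longrightarrow> Y \<in> sp n \<Longrightarrow> P X \<Longrightarrow> P Y \<Longrightarrow> P (X + Y)"
    and smult: "\<And>c X. X \<in> sp n \<Longrightarrow> P X \<Longrightarrow> P (c \<cdot>\<^sub>m X)"
  shows "P X"
proof -
  \<comment> \<open>Up to sign and the factor one half, these are the entries of the symmetric
    matrix behind \<open>sp_iff\<close>. The half compensates for \<open>root_mat\<close> being
    symmetrised in its two indices.\<close>
  define f where "f = (\<lambda>(p, q). X $$ (p, opp n q) * eps n q / 2)"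
  \<comment> \<open>Summing over a variable index set lets the closure hypotheses be applied by
    finite induction.\<close>
  define Z where "Z S = mat (2 * n) (2 * n) (\<lambda>rc. \<Sum>(p, q)\<in>S. f (p, q) * root_mat n p q $$ rc)" for S
  have Z: "P (Z S) \<and> Z S \<in> sp n" if "finite S" "S \<subseteq> {..<2*n} \<times> {..<2*n}" for S
    using that
  proof (induction S)
    case empty
    have "Z {} = 0\<^sub>m (2 * n) (2 * n)" by (auto simp: Z_def)
    then show ?case using zero by simp
  next
    case (insert x S)
    obtain p q where x: "x = (p, q)" by (cases x)
    have "Z (insert x S) = f x \<cdot>\<^sub>m root_mat n p q + Z S"
      using insert x by (intro eq_matI) (auto simp: Z_def)
    then show ?case using insert x root_mat smult add by auto
  qed
  have "X = Z ({..<2*n} \<times> {..<2*n})"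
  proof (rule eq_matI)
    fix r c assume "r < dim_row (Z ({..<2*n} \<times> {..<2*n}))" "c < dim_col (Z ({..<2*n} \<times> {..<2*n}))"
    then have rc: "r < 2 * n" "c < 2 * n" by (simp_all add: Z_def)
    have "Z ({..<2*n} \<times> {..<2*n}) $$ (r, c) = (\<Sum>p<2*n. \<Sum>q<2*n. f (p, q) * root_mat n p q $$ (r, c))"
      using rc by (simp add: Z_def sum.cartesian_product)
    also have "\<dots> = (\<Sum>p<2*n. \<Sum>q<2*n. if r = p then f (p, q) * omega n q c else 0)
        + (\<Sum>p<2*n. \<Sum>q<2*n. if r = q then f (p, q) * omega n p c else 0)"
      unfolding sum.distrib[symmetric] using rc by (intro sum.cong refl) (auto simp: root_mat_index algebra_simps)
    also have "(\<Sum>p<2*n. \<Sum>q<2*n. if r = p then f (p, q) * omega n q c else 0) = (\<Sum>q<2*n. f (r, q) * omega n q c)"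
      using rc by (subst sum.swap) simp
    also have "(\<Sum>p<2*n. \<Sum>q<2*n. if r = q then f (p, q) * omega n p c else 0) = (\<Sum>p<2*n. f (p, r) * omega n p c)"
      using rc by simp
    also have "(\<Sum>q<2*n. f (r, q) * omega n q c) + (\<Sum>p<2*n. f (p, r) * omega n p c)
       = - eps n c * (f (r, opp n c) + f (opp n c, r))"
      unfolding sum_omega(1)[OF rc(2)] by (simp add: distrib_left mult.commute)
    also have "f (opp n c, r) = f (r, opp n c)"
      using X[unfolded sp_iff, THEN conjunct2, rule_format, of "opp n c" r] rc by (simp add: f_def)
    also have "- eps n c * (f (r, opp n c) + f (r, opp n c)) = X $$ (r, c)"
      using rc by (simp add: f_def)
    finally show "X $$ (r, c) = Z ({..<2*n} \<times> {..<2*n}) $$ (r, c)"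
      using rc by simp
  qed (use sp_carrier[OF X] in \<open>auto simp: Z_def\<close>)
  then show ?thesis using Z[of "{..<2*n} \<times> {..<2*n}"] by simp
qed

section \<open>Distances in the symplectic lattice\<close>

definition l1_norm :: "int vec \<Rightarrow> int" where
  "l1_norm u = (\<Sum>i<dim_vec u. \<bar>u $ i\<bar>)"

text \<open>Holds termwise, since \<open>\<bar>x\<bar> + x\<close> is \<open>0\<close> or
  \<open>2 * x\<close>.\<close>

lemma even_l1_norm_iff: "even (l1_norm u) \<longleftrightarrow> even (\<Sum>i<dim_vec u. u $ i)"
proof -
  have "even (l1_norm u + (\<Sum>i<dim_vec u. u $ i))"
    unfolding l1_norm_def sum.distrib[symmetric] by (intro dvd_sum) (auto simp: abs_if)
  then show ?thesis by simp
qed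

lemma sum_wt: "p < 2 * n \<Longrightarrow> (\<Sum>i<n. wt n p $ i) = (eps n p :: int)"
proof -
  assume p: "p < 2 * n"
  have "(\<Sum>i<n. wt n p $ i) = (\<Sum>i<n. if i = (if p < n then p else p - n) then eps n p else (0::int))"
    using p by (intro sum.cong) (auto simp: wt_def eps_def)
  then show ?thesis using p by (cases "p < n") auto
qed

lemma l1_norm_wt: "p < 2 * n \<Longrightarrow> l1_norm (wt n p) = 1"
proof -
  assume p: "p < 2 * n"
  have "l1_norm (wt n p) = (\<Sum>i<n. if i = (if p < n then p else p - n) then 1 else (0::int))"
    unfolding l1_norm_def using p by (intro sum.cong) (auto simp: wt_def)
  then show ?thesis using p by (cases "p < n") auto
qed

lemma l1_norm_triangle:
  "u \<in> carrier_vec n \<Longrightarrow> v \<in> carrier_vec n \<Longrightarrow> l1_norm (u + v) \<le> l1_norm u + l1_norm v"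
  unfolding l1_norm_def by (auto simp: sum.distrib[symmetric] intro!: sum_mono abs_triangle_ineq)

text \<open>Coordinates are integers, so a unit step in a direction where \<open>x\<close> lies
  strictly below \<open>y\<close> cannot overshoot; in the opposite direction it only
  decreases.\<close>

lemma ext_coord_less_unit_step:
  fixes x y :: "int vec"
  assumes x: "x \<in> carrier_vec n" and y: "y \<in> carrier_vec n" and p: "p < 2 * n"
    and less: "ext_coord n x p < ext_coord n y p"
  shows "r < 2 * n \<Longrightarrow> ext_coord n (x + wt n p) r \<le> max (ext_coord n x r) (ext_coord n y r)"
    and "l1_norm (x + wt n p - y) = l1_norm (x - y) - 1"
proof -
  assume r: "r < 2 * n"
  show "ext_coord n (x + wt n p) r \<le> max (ext_coord n x r) (ext_coord n y r)"
    using x p r less by (auto simp: ext_coord_wt)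
next
  define i where "i = (if p < n then p else p - n)"
  have i: "i < n" using p by (auto simp: i_def)
  have eq: "l1_norm u = \<bar>u $ i\<bar> + (\<Sum>j\<in>{..<n} - {i}. \<bar>u $ j\<bar>)" if "u \<in> carrier_vec n" for u :: "int vec"
    using that i unfolding l1_norm_def by (subst sum.remove[of _ i]) auto
  have "(\<Sum>j\<in>{..<n} - {i}. \<bar>(x + wt n p - y) $ j\<bar>) = (\<Sum>j\<in>{..<n} - {i}. \<bar>(x - y) $ j\<bar>)"
    using x y p by (intro sum.cong) (auto simp: wt_def i_def split: if_splits)
  moreover have "\<bar>(x + wt n p - y) $ i\<bar> = \<bar>(x - y) $ i\<bar> - 1"
    using x y p i less by (auto simp: wt_def i_def ext_coord_def split: if_splits)
  moreover have "x + wt n p - y \<in> carrier_vec n" "x - y \<in> carrier_vec n"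
    using x y by auto
  ultimately show "l1_norm (x + wt n p - y) = l1_norm (x - y) - 1"
    by (simp add: eq)
qed

lemma ext_coord_less_exists:
  fixes x y :: "int vec"
  assumes "x \<in> carrier_vec n" "y \<in> carrier_vec n" "x \<noteq> y"
  obtains p where "p < 2 * n" "ext_coord n x p < ext_coord n y p"
proof -
  obtain i where i: "i < n" "x $ i \<noteq> y $ i" using assms by (metis eq_vecI carrier_vecD)
  show ?thesis
  proof (cases "x $ i < y $ i")
    case True
    then show ?thesis using i that[of i] by (simp add: ext_coord_def)
  next
    case False
    \<comment> \<open>Index \<open>i + n\<close> reads the \<open>i\<close>-th coordinate negated,
      which turns a surplus into a deficit.\<close>
    then show ?thesis using i that[of "i + n"] by (simp add: ext_coord_def)
  qed
qed

text \<open>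
  Any two points whose difference has even \<open>l\<^sub>1\<close>-norm are joined by steps along roots, each lowering
  the distance by \<open>2\<close> and staying between the endpoints in every coordinate.
  This produces shortest paths in the lattice, and also the descent inside the set of weights.
\<close>

lemma lattice_step_induct [consumes 3, case_names base step]:
  fixes x y :: "int vec"
  assumes "x \<in> carrier_vec n" and y: "y \<in> carrier_vec n" and "even (l1_norm (x - y))"
    and "P x"
    and step: "\<And>x p q. x \<in> carrier_vec n \<Longrightarrow> P x \<Longrightarrow> p < 2 * n \<Longrightarrow> q < 2 * n \<Longrightarrow> q \<noteq> opp n p \<Longrightarrow>
       ext_coord n x p < ext_coord n y p \<Longrightarrow> ext_coord n x q < ext_coord n y q \<Longrightarrow>
       l1_norm (x + (wt n p + wt n q) - y) = l1_norm (x - y) - 2 \<Longrightarrow>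
       (\<And>r. r < 2 * n \<Longrightarrow> ext_coord n (x + (wt n p + wt n q)) r \<le> max (ext_coord n x r) (ext_coord n y r)) \<Longrightarrow>
       P (x + (wt n p + wt n q))"
  shows "P y"
  using assms(1,3,4)
proof (induction "nat (l1_norm (x - y))" arbitrary: x rule: less_induct)
  case less
  note x = \<open>x \<in> carrier_vec n\<close>
  show ?case
  proof (cases "x = y")
    case False
    then obtain p where p: "p < 2 * n" "ext_coord n x p < ext_coord n y p"
      using ext_coord_less_exists x y by blast
    define x1 where "x1 = x + wt n p"
    have x1: "x1 \<in> carrier_vec n" using x by (simp add: x1_def)
    note s1 = ext_coord_less_unit_step[OF x y p, folded x1_def]
    \<comment> \<open>By parity one unit step cannot already arrive at \<open>y\<close>, so a second
      one exists, and the two combine to a root.\<close>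
    have "odd (l1_norm (x1 - y))" using s1(2) less.prems by simp
    then have "x1 \<noteq> y" using y by (auto simp: l1_norm_def)
    then obtain q where q: "q < 2 * n" "ext_coord n x1 q < ext_coord n y q"
      using ext_coord_less_exists x1 y by blast
    note s2 = ext_coord_less_unit_step[OF x1 y q]
    have x2: "x1 + wt n q = x + (wt n p + wt n q)"
      using x by (simp add: x1_def assoc_add_vec[of _ n])
    \<comment> \<open>After the first step \<open>x1\<close> does not exceed \<open>y\<close> in
      direction \<open>p\<close>, so it is not below \<open>y\<close> in the opposite direction: the
      two unit steps cannot cancel.\<close>
    have qp: "q \<noteq> opp n p" using p q x by (auto simp: x1_def ext_coord_wt)
    have nonneg: "l1_norm u \<ge> 0" for u unfolding l1_norm_def by (intro sum_nonneg) auto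
    have l: "l1_norm (x + (wt n p + wt n q) - y) = l1_norm (x - y) - 2"
      using s1(2) s2(2) by (simp add: x2)
    show ?thesis
    proof (rule less.hyps)
      show "nat (l1_norm (x + (wt n p + wt n q) - y)) < nat (l1_norm (x - y))"
        using l nonneg[of "x + (wt n p + wt n q) - y"] by linarith
      show "P (x + (wt n p + wt n q))"
      proof (rule step)
        show "ext_coord n x q < ext_coord n y q"
          using q p qp x by (auto simp: x1_def ext_coord_wt split: if_splits)
        show "ext_coord n (x + (wt n p + wt n q)) r \<le> max (ext_coord n x r) (ext_coord n y r)"
          if "r < 2 * n" for r
          using s1(1)[OF that] s2(1)[OF that] unfolding x2 by linarith
      qed (use less.prems p q qp l in auto)
    qed (use x l less.prems in auto)
  qed (use less.prems in simp)
qed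

text \<open>Each arc changes the norm by at most 2, which bounds every walk from below; a walk built
  by \<open>lattice_step_induct\<close> attains the bound.\<close>

lemma graph_distance_symplectic_lattice:
  assumes l: "l \<in> lattice_points M n" and l': "l' \<in> lattice_points M n"
  shows "graph_distance (symplectic_lattice M n) l l' = ereal (real_of_int (l1_norm (l - l')) / 2)"
proof -
  define G where "G = symplectic_lattice M n"
  interpret wf_digraph G unfolding G_def by (rule wf_digraph_symplectic_lattice)
  have G: "verts G = lattice_points M n" "tail G = fst" "head G = snd"
    "arcs G = {(l, l'). l \<in> lattice_points M n \<and> l' \<in> lattice_points M n \<and> l - l' \<in> roots n}"
    by (simp_all add: G_def symplectic_lattice_def)
  have carr: "u \<in> carrier_vec n" if "u \<in> lattice_points M n" for u
    using that by (simp add: lattice_points_def)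
  have cost: "awalk_cost (\<lambda>_. 1) p = length p" for p :: "(int vec \<times> int vec) list"
    by (induction p) (simp_all add: awalk_cost_def)
  have lower: "l1_norm (u - l') \<le> 2 * int (length p)" if "awalk u p l'" for u p
    using that
  proof (induction p arbitrary: u)
    case Nil
    then have "u = l'" by (simp add: awalk_Nil_iff)
    then show ?case using carr[OF l'] by (simp add: l1_norm_def)
  next
    case (Cons e p)
    obtain a b where e: "e = (a, b)" by (cases e)
    from Cons.prems have ab: "a = u" "a \<in> lattice_points M n" "b \<in> lattice_points M n"
        "a - b \<in> roots n" "awalk b p l'"
      by (auto simp: awalk_Cons_iff G e)
    have "l1_norm (a - b) \<le> 2"
    proof -
      obtain p q where "p < 2 * n" "q < 2 * n" "a - b = wt n p + wt n q"
        using ab unfolding roots_eq_wt by blast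
      then show ?thesis
        using l1_norm_triangle[of "wt n p" n "wt n q"] by (simp add: l1_norm_wt)
    qed
    moreover have "u - l' = (a - b) + (b - l')"
      using carr[OF ab(2)] carr[OF ab(3)] carr[OF l'] ab(1) by auto
    moreover have "l1_norm ((a - b) + (b - l')) \<le> l1_norm (a - b) + l1_norm (b - l')"
      using carr[OF ab(2)] carr[OF ab(3)] carr[OF l'] by (intro l1_norm_triangle[of _ n]) auto
    ultimately show ?case using Cons.IH[OF ab(5)] by simp
  qed
  have "even (l1_norm (l - l'))"
    using l l' by (auto simp: even_l1_norm_iff lattice_points_def sum_subtractf)
  \<comment> \<open>The term \<open>l1_norm (l' - l')\<close> is zero. It keeps the goal an instance
    of the invariant, in which twice the length of the walk so far is the decrease of the
    norm.\<close>
  with carr[OF l] carr[OF l'] have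
    "l' \<in> lattice_points M n \<and> (\<exists>p. awalk l p l' \<and> 2 * int (length p) = l1_norm (l - l') - l1_norm (l' - l'))"
  proof (induct rule: lattice_step_induct[where P = "\<lambda>x. x \<in> lattice_points M n \<and>
      (\<exists>p. awalk l p x \<and> 2 * int (length p) = l1_norm (l - l') - l1_norm (x - l'))"])
    case base
    then show ?case using l by (auto simp: awalk_Nil_iff G intro!: exI[of _ "[]"])
  next
    case (step x p q)
    define z where "z = x + (wt n p + wt n q)"
    have zc: "z \<in> carrier_vec n" using step(1) by (simp add: z_def)
    have zl: "z \<in> lattice_points M n"
    proof -
      have "0 \<le> z $ i \<and> z $ i \<le> 2 * int M" if i: "i < n" for i
      proof -
        have "0 \<le> u $ i \<and> u $ i \<le> 2 * int M" if "u \<in> {x, l'}" for u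
          using that step(2) l' i by (auto simp: lattice_points_def)
        \<comment> \<open>Direction \<open>i\<close> gives the upper bound of the box, direction
          \<open>i + n\<close> the lower one.\<close>
        then show ?thesis
          using step(9)[of i] step(9)[of "i + n"] i by (fastforce simp: z_def[symmetric] ext_coord_def max_def split: if_splits)
      qed
      moreover have "(\<Sum>i<n. z $ i) = (\<Sum>i<n. x $ i) + (eps n p + eps n q)"
        unfolding sum_wt[OF step(3), symmetric] sum_wt[OF step(4), symmetric] sum.distrib[symmetric]
        using step(1) by (intro sum.cong) (auto simp: z_def)
      moreover have "even (\<Sum>i<n. x $ i)" using step(2) by (auto simp: lattice_points_def)
      ultimately show ?thesis using zc by (auto simp: lattice_points_def eps_def)
    qed
    from step(2) obtain w where w: "awalk l w x" "2 * int (length w) = l1_norm (l - l') - l1_norm (x - l')"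
      by blast
    \<comment> \<open>An arc asks for tail minus head to be a root, so the step is negated, which
      replaces both indices by their \<open>opp\<close>.\<close>
    have "x - z = wt n (opp n p) + wt n (opp n q)"
      using step(1,3,4) by (auto simp: wt_opp z_def)
    moreover have "opp n p < 2 * n" "opp n q < 2 * n" "opp n q \<noteq> opp n (opp n p)"
      using step(3,4,5) by auto
    ultimately have "x - z \<in> roots n" unfolding roots_eq_wt by blast
    with zl have "awalk l (w @ [(x, z)]) z"
      using w(1) step(2) by (auto intro!: awalk_appendI simp: awalk_Cons_iff awalk_Nil_iff G)
    moreover have "2 * int (length (w @ [(x, z)])) = l1_norm (l - l') - l1_norm (z - l')"
      using w(2) step(8) by (simp add: z_def)
    ultimately show ?case using zl unfolding z_def by blast
  qed
  then obtain p where p: "awalk l p l'" "2 * int (length p) = l1_norm (l - l')"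
    using carr[OF l'] by (auto simp: l1_norm_def)
  have lp: "real (length p) = real_of_int (l1_norm (l - l')) / 2"
    using p(2) by linarith
  have "\<mu> (\<lambda>_. 1) l l' = ereal (real (length p))"
  proof (rule antisym)
    show "\<mu> (\<lambda>_. 1) l l' \<le> ereal (real (length p))"
      using min_cost_le_walk_cost[OF p(1), of "\<lambda>_. 1"] by (simp add: cost)
    show "ereal (real (length p)) \<le> \<mu> (\<lambda>_. 1) l l'"
      unfolding \<mu>_def
    proof (rule INF_greatest)
      fix q assume "q \<in> {q. awalk l q l'}"
      then have "int (length p) \<le> int (length q)" using lower[of l q] p(2) by simp
      then show "ereal (real (length p)) \<le> ereal (awalk_cost (\<lambda>_. 1) q)" by (simp add: cost)
    qed
  qed
  then show ?thesis by (simp add: graph_distance_def G_def lp)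
qed

section \<open>Weights of the representation\<close>

text \<open>The value of the weight \<open>m\<close> on the coroot of the root \<open>wt n p + wt n q\<close>.\<close>

definition pairing :: "nat \<Rightarrow> int vec \<Rightarrow> nat \<Rightarrow> nat \<Rightarrow> int" where
  "pairing n m p q = (if p = q then ext_coord n m p else ext_coord n m p + ext_coord n m q)"

lemma functional_coroot:
  "p < 2 * n \<Longrightarrow> q < 2 * n \<Longrightarrow> functional n m (coroot n p q) = of_int (pairing n m p q)"
  by (simp add: coroot_def pairing_def functional_wt_right functional_add_right)

section \<open>Weight vectors and finiteness of the set of weights\<close>

context sp_representation
begin

lemma rep_vadd: "X \<in> sp n \<Longrightarrow> \<rho> X (u + v) = \<rho> X u + \<rho> X v"
  using rep_linear[of X] by (simp add: Vector_Spaces.linear_iff)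

lemma rep_vscale: "X \<in> sp n \<Longrightarrow> \<rho> X (scl c v) = scl c (\<rho> X v)"
  using rep_linear[of X] by (simp add: Vector_Spaces.linear_iff)

lemma rep_vzero [simp]: "X \<in> sp n \<Longrightarrow> \<rho> X 0 = 0"
  using rep_vscale[of X 0 0] by simp

lemma rep_vsum: "X \<in> sp n \<Longrightarrow> \<rho> X (\<Sum>i\<in>I. f i) = (\<Sum>i\<in>I. \<rho> X (f i))"
  by (induction I rule: infinite_finite_induct) (simp_all add: rep_vadd)

lemma rep_zero: "\<rho> (0\<^sub>m (2 * n) (2 * n)) v = 0"
proof -
  have "0 \<cdot>\<^sub>m (0\<^sub>m (2 * n) (2 * n)) = (0\<^sub>m (2 * n) (2 * n) :: complex mat)" by auto
  then show ?thesis using rep_smult[of "0\<^sub>m (2 * n) (2 * n)" 0 v] by simp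
qed

lemma weight_spaceD:
  "v \<in> weight_space m \<Longrightarrow> h \<in> carrier_vec n \<Longrightarrow> \<rho> (cartan n h) v = scl (functional n m h) v"
  by (simp add: weight_space_def)

lemma zero_in_weight_space [simp]: "0 \<in> weight_space m"
  by (simp add: weight_space_def)

lemma add_in_weight_space: "u \<in> weight_space m \<Longrightarrow> v \<in> weight_space m \<Longrightarrow> u + v \<in> weight_space m"
  by (simp add: weight_space_def rep_vadd scale_right_distrib)

lemma scale_in_weight_space: "u \<in> weight_space m \<Longrightarrow> scl c u \<in> weight_space m"
  by (simp add: weight_space_def rep_vscale mult.commute)

lemma minus_in_weight_space: "u \<in> weight_space m \<Longrightarrow> - u \<in> weight_space m"
  using scale_in_weight_space[of u m "- 1"] by simp

lemma root_mat_weight_space: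
  assumes p: "p < 2 * n" and q: "q < 2 * n" and m: "m \<in> carrier_vec n" and v: "v \<in> weight_space m"
  shows "\<rho> (root_mat n p q) v \<in> weight_space (m + (wt n p + wt n q))"
  unfolding weight_space_def
proof (intro CollectI ballI)
  fix h :: "complex vec" assume h: "h \<in> carrier_vec n"
  let ?X = "root_mat n p q" and ?c = "ext_coord n h p + ext_coord n h q"
  have "\<rho> (bracket (cartan n h) ?X) v = \<rho> (cartan n h) (\<rho> ?X v) - \<rho> ?X (\<rho> (cartan n h) v)"
    using p q by (simp add: rep_bracket)
  moreover have "\<rho> (bracket (cartan n h) ?X) v = scl ?c (\<rho> ?X v)"
    using p q by (simp add: bracket_cartan_root_mat rep_smult)
  moreover have "\<rho> ?X (\<rho> (cartan n h) v) = scl (functional n m h) (\<rho> ?X v)"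
    using v h p q by (simp add: weight_spaceD rep_vscale)
  ultimately have "\<rho> (cartan n h) (\<rho> ?X v) = scl ?c (\<rho> ?X v) + scl (functional n m h) (\<rho> ?X v)"
    by (simp add: algebra_simps)
  then show "\<rho> (cartan n h) (\<rho> ?X v) = scl (functional n (m + (wt n p + wt n q)) h) (\<rho> ?X v)"
    using p q m by (simp add: functional_add functional_wt scale_left_distrib[symmetric] add.commute)
qed

lemma root_mat_funpow_weight_space:
  assumes p: "p < 2 * n" and q: "q < 2 * n" and m: "m \<in> carrier_vec n" and v: "v \<in> weight_space m"
  shows "(\<rho> (root_mat n p q) ^^ k) v \<in> weight_space (m + int k \<cdot>\<^sub>v (wt n p + wt n q))"
proof (induction k)
  case 0
  have "m + int 0 \<cdot>\<^sub>v (wt n p + wt n q) = m" using m by auto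
  then show ?case using v by simp
next
  case (Suc k)
  have "m + int k \<cdot>\<^sub>v (wt n p + wt n q) + (wt n p + wt n q) = m + int (Suc k) \<cdot>\<^sub>v (wt n p + wt n q)"
    using m by (intro eq_vecI) (auto simp: algebra_simps)
  then show ?case
    using root_mat_weight_space[OF p q _ Suc.IH] m by simp
qed

text \<open>For an \<open>h\<close> separating \<open>\<mu>\<close> from another weight, applying
  \<open>cartan n h\<close> minus its eigenvalue at \<open>\<mu>\<close> removes one term of the
  relation; induction handles the rest.\<close>

lemma independent_weight_vectors:
  assumes "finite S" "S \<subseteq> carrier_vec n" "\<And>\<nu>. \<nu> \<in> S \<Longrightarrow> f \<nu> \<in> weight_space \<nu>" "(\<Sum>\<nu>\<in>S. f \<nu>) = 0"
  shows "\<forall>\<nu>\<in>S. f \<nu> = 0"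
  using assms
proof (induction S arbitrary: f)
  case (insert \<mu> S)
  have zero: "f \<nu> = 0" if \<nu>: "\<nu> \<in> S" for \<nu>
  proof -
    have "\<nu> \<noteq> \<mu>" using \<nu> insert by auto
    then obtain h where h: "h \<in> carrier_vec n" "functional n \<nu> h \<noteq> functional n \<mu> h"
      using functional_inj[of \<nu> n \<mu>] insert.prems(1) \<nu> by auto
    define g where "g \<kappa> = scl (functional n \<kappa> h - functional n \<mu> h) (f \<kappa>)" for \<kappa>
    have "(\<Sum>\<kappa>\<in>insert \<mu> S. g \<kappa>) = (\<Sum>\<kappa>\<in>insert \<mu> S. \<rho> (cartan n h) (f \<kappa>)) - scl (functional n \<mu> h) (\<Sum>\<kappa>\<in>insert \<mu> S. f \<kappa>)"
      unfolding scale_sum_right sum_subtractf[symmetric]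
      using weight_spaceD[OF insert.prems(2) h(1)] by (intro sum.cong) (simp_all add: g_def scale_left_diff_distrib)
    also have "\<dots> = 0"
      by (simp only: rep_vsum[OF cartan_sp, symmetric] insert.prems(3)) simp
    finally have "(\<Sum>\<kappa>\<in>S. g \<kappa>) = 0" using insert.hyps by (simp add: g_def)
    then have "\<forall>\<kappa>\<in>S. g \<kappa> = 0"
      using insert.prems by (intro insert.IH) (auto simp: g_def scale_in_weight_space)
    then show ?thesis using \<nu> h(2) by (auto simp: g_def)
  qed
  then show ?case using insert by (simp add: sum.neutral)
qed simp

text \<open>Nonzero vectors of distinct weights are independent, so their number is bounded by the
  size of a finite spanning set.\<close>

lemma finite_weights: "finite weights"
proof (rule ccontr)
  assume inf: "infinite weights"
  obtain B where B: "finite B" "span B = UNIV" using finite_dim by blast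
  have "\<forall>m\<in>weights. \<exists>v. v \<in> weight_space m \<and> v \<noteq> 0" by (auto simp: weights_def)
  then obtain w where w: "\<And>m. m \<in> weights \<Longrightarrow> w m \<in> weight_space m" "\<And>m. m \<in> weights \<Longrightarrow> w m \<noteq> 0"
    by metis
  obtain S where S: "S \<subseteq> weights" "finite S" "card S = Suc (card B)"
    using infinite_arbitrarily_large[OF inf] by metis
  have Sc: "S \<subseteq> carrier_vec n" using S by (auto simp: weights_def)
  have inj: "inj_on w S"
  proof (rule inj_onI, rule ccontr)
    fix m m' assume mm: "m \<in> S" "m' \<in> S" "w m = w m'" "m \<noteq> m'"
    \<comment> \<open>Equal representatives of two weights would give the relation
      \<open>w m - w m' = 0\<close> between different weight spaces.\<close>
    define f where "f \<kappa> = (if \<kappa> = m then w m else - w m')" for \<kappa>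
    have "w m \<in> weight_space m" "- w m' \<in> weight_space m'"
      using mm(1,2) S(1) w(1) by (auto intro: minus_in_weight_space)
    then have "\<And>\<nu>. \<nu> \<in> {m, m'} \<Longrightarrow> f \<nu> \<in> weight_space \<nu>"
      using mm(4) by (auto simp: f_def)
    then have "\<forall>\<nu>\<in>{m, m'}. f \<nu> = 0"
      using mm Sc by (intro independent_weight_vectors) (auto simp: f_def)
    then show False using mm S w by (auto simp: f_def)
  qed
  have "independent (w ` S)"
    unfolding dependent_finite[OF finite_imageI[OF S(2)]]
  proof (clarify)
    fix u m assume u: "(\<Sum>v\<in>w ` S. scl (u v) v) = 0" "m \<in> S" "u (w m) \<noteq> 0"
    have "\<forall>\<nu>\<in>S. scl (u (w \<nu>)) (w \<nu>) = 0"
      using S Sc u(1) by (intro independent_weight_vectors)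
        (auto simp: sum.reindex[OF inj] w intro!: scale_in_weight_space)
    then show False using u S w by auto
  qed
  then have "card (w ` S) \<le> card B"
    using independent_span_bound[OF B(1)] B(2) by auto
  then show False using S card_image[OF inj] by simp
qed

text \<open>Otherwise all powers would be nonzero on \<open>v\<close>, and adding multiples of the
  root to \<open>m\<close> would give infinitely many weights.\<close>

lemma root_mat_nilpotent:
  assumes p: "p < 2 * n" and q: "q < 2 * n" and pq: "q \<noteq> opp n p"
    and m: "m \<in> carrier_vec n" and v: "v \<in> weight_space m" "v \<noteq> 0"
  obtains k where "(\<rho> (root_mat n p q) ^^ k) v \<noteq> 0" "(\<rho> (root_mat n p q) ^^ Suc k) v = 0"
proof (rule ccontr)
  assume "\<not> thesis"
  then have step: "(\<rho> (root_mat n p q) ^^ Suc k) v \<noteq> 0" if "(\<rho> (root_mat n p q) ^^ k) v \<noteq> 0" for k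
    using that \<open>\<And>k. \<lbrakk>(\<rho> (root_mat n p q) ^^ k) v \<noteq> 0; (\<rho> (root_mat n p q) ^^ Suc k) v = 0\<rbrakk> \<Longrightarrow> thesis\<close> by blast
  have nz: "(\<rho> (root_mat n p q) ^^ k) v \<noteq> 0" for k
    by (induction k) (use v step in auto)
  let ?m = "\<lambda>k. m + int k \<cdot>\<^sub>v (wt n p + wt n q)"
  have "range ?m \<subseteq> weights"
    using nz root_mat_funpow_weight_space[OF p q m v(1)] m by (auto simp: weights_def)
  moreover have "inj ?m"
  proof (rule injI)
    fix i j assume "?m i = ?m j"
    then have "ext_coord n (?m i) p = ext_coord n (?m j) p" by simp
    then show "i = j" using p q pq m by (auto simp: ext_coord_wt opp_eq_iff split: if_splits)
  qed
  ultimately show False using finite_weights finite_subset range_inj_infinite by blast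
qed

section \<open>Strings of weights from sl2-theory\<close>

text \<open>With \<open>E\<close>, \<open>F\<close> the two opposite operators and \<open>c\<close>
  the pairing, \<open>E (F^(j+1) v)\<close> is a nonzero constant times
  \<open>(j+1) * (c - j)\<close> times \<open>F^j v\<close>. At the last nonvanishing power
  \<open>k\<close> this is zero, forcing \<open>c = k\<close>.\<close>

lemma sl2_string:
  assumes p: "p < 2 * n" and q: "q < 2 * n" and pq: "q \<noteq> opp n p"
    and m: "m \<in> carrier_vec n" and v: "v \<in> weight_space m" "v \<noteq> 0"
    and kill: "\<rho> (root_mat n p q) v = 0"
  obtains k where "pairing n m p q = int k"
    "(\<rho> (root_mat n (opp n p) (opp n q)) ^^ k) v \<noteq> 0"
    "(\<rho> (root_mat n (opp n p) (opp n q)) ^^ Suc k) v = 0"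
proof -
  let ?E = "\<rho> (root_mat n p q)" and ?F = "\<rho> (root_mat n (opp n p) (opp n q))"
  define c where "c = (of_int (pairing n m p q) :: complex)"
  let ?\<beta> = "wt n (opp n p) + wt n (opp n q) :: int vec"
  have qp: "opp n q \<noteq> opp n (opp n p)" using p q pq by auto
  \<comment> \<open>A root takes the value 2 on its own coroot, so each application of
    \<open>?F\<close> lowers the pairing by 2.\<close>
  have pair: "pairing n (m + int j \<cdot>\<^sub>v ?\<beta>) p q = pairing n m p q - 2 * int j" for j
    using p q pq m by (auto simp: pairing_def ext_coord_wt opp_eq_iff)
  have EF: "?E (?F w) = scl (coroot_coeff n p q * (c - 2 * of_nat j)) w + ?F (?E w)"
    if w: "w \<in> weight_space (m + int j \<cdot>\<^sub>v ?\<beta>)" for w j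
  proof -
    have "\<rho> (bracket (root_mat n p q) (root_mat n (opp n p) (opp n q))) w = ?E (?F w) - ?F (?E w)"
      using p q by (simp add: rep_bracket)
    moreover have "\<rho> (bracket (root_mat n p q) (root_mat n (opp n p) (opp n q))) w
        = scl (coroot_coeff n p q * (c - 2 * of_nat j)) w"
      using p q pq w by (simp add: bracket_root_mat_opp rep_smult weight_spaceD functional_coroot pair c_def)
    ultimately show ?thesis by (simp add: algebra_simps)
  qed
  have string: "?E ((?F ^^ Suc j) v) = scl (coroot_coeff n p q * (of_nat (Suc j) * (c - of_nat j))) ((?F ^^ j) v)" for j
  proof (induction j)
    case 0
    have "m + int 0 \<cdot>\<^sub>v ?\<beta> = m" using m by auto
    then show ?case using EF[of v 0] v kill p q by simp
  next
    case (Suc j)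
    have "?E ((?F ^^ Suc (Suc j)) v) = scl (coroot_coeff n p q * (c - 2 * of_nat (Suc j))) ((?F ^^ Suc j) v)
        + ?F (scl (coroot_coeff n p q * (of_nat (Suc j) * (c - of_nat j))) ((?F ^^ j) v))"
      using EF[OF root_mat_funpow_weight_space[OF opp_less[OF p] opp_less[OF q] m v(1)], of "Suc j"] Suc.IH by simp
    also have "\<dots> = scl (coroot_coeff n p q * (c - 2 * of_nat (Suc j))
        + coroot_coeff n p q * (of_nat (Suc j) * (c - of_nat j))) ((?F ^^ Suc j) v)"
      using p q by (simp add: rep_vscale scale_left_distrib)
    also have "coroot_coeff n p q * (c - 2 * of_nat (Suc j)) + coroot_coeff n p q * (of_nat (Suc j) * (c - of_nat j))
       = coroot_coeff n p q * (of_nat (Suc (Suc j)) * (c - of_nat (Suc j)))"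
      by (simp add: algebra_simps)
    finally show ?case .
  qed
  obtain k where k: "(?F ^^ k) v \<noteq> 0" "(?F ^^ Suc k) v = 0"
    using root_mat_nilpotent[OF opp_less[OF p] opp_less[OF q] qp m v] by blast
  have "scl (coroot_coeff n p q * (of_nat (Suc k) * (c - of_nat k))) ((?F ^^ k) v) = 0"
    using string[of k] k(2) p q by simp
  then have "c = of_nat k" using k(1) by (simp del: of_nat_Suc)
  then have "pairing n m p q = int k" unfolding c_def by (metis of_int_eq_iff of_int_of_nat_eq)
  then show ?thesis using that k by blast
qed

text \<open>By \<open>sl2_string\<close> a weight vector killed by the root operator has nonnegative
  pairing, so here the operator yields a nonzero vector.\<close>

lemma weights_step:
  assumes p: "p < 2 * n" and q: "q < 2 * n" and pq: "q \<noteq> opp n p"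
    and m: "m \<in> weights" and neg: "pairing n m p q < 0"
  shows "m + (wt n p + wt n q) \<in> weights"
proof -
  obtain v where v: "m \<in> carrier_vec n" "v \<in> weight_space m" "v \<noteq> 0" using m by (auto simp: weights_def)
  have "\<rho> (root_mat n p q) v \<noteq> 0"
    using sl2_string[OF p q pq v] neg by force
  then show ?thesis
    using root_mat_weight_space[OF p q v(1,2)] v(1) by (auto simp: weights_def)
qed

text \<open>
  The operators with \<open>n \<le> p, q\<close> span the nilradical opposite to the Siegel parabolic subalgebra.
  They only lower coordinates, and by an even amount in total.
\<close>

inductive_set descendants :: "'v \<Rightarrow> 'v set" for v where
  base: "v \<in> descendants v"
| step: "w \<in> descendants v \<Longrightarrow> n \<le> p \<Longrightarrow> p < 2 * n \<Longrightarrow> n \<le> q \<Longrightarrow> q < 2 * n \<Longrightarrow>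
         \<rho> (root_mat n p q) w \<in> descendants v"

section \<open>Generation from the highest weight vector\<close>

lemma rep_span_subset:
  assumes X: "X \<in> sp n" and D: "\<And>w. w \<in> D \<Longrightarrow> \<rho> X w \<in> span D'" and x: "x \<in> span D"
  shows "\<rho> X x \<in> span D'"
  using x
  by (induction rule: span_induct_alt) (use X D in \<open>auto simp: rep_vadd rep_vscale span_zero intro!: span_add span_scale\<close>)

text \<open>On \<open>v\<close> itself the parabolic part acts by scalars and the rest produces
  descendants. Further down, induction runs over all \<open>X\<close> at once: \<open>X\<close>
  moves past the outermost lowering operator at the cost of a bracket, which again lies in the
  algebra.\<close>

lemma span_descendants_invariant:
  assumes v: "\<And>p q. p < 2 * n \<Longrightarrow> q < 2 * n \<Longrightarrow> p < n \<or> q < n \<Longrightarrow> \<exists>c. \<rho> (root_mat n p q) v = scl c v"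
    and X: "X \<in> sp n" and x: "x \<in> span (descendants v)"
  shows "\<rho> X x \<in> span (descendants v)"
proof -
  have base: "\<rho> X v \<in> span (descendants v)" if "X \<in> sp n" for X
    using that
  proof (induction rule: sp_induct)
    case zero
    then show ?case by (simp add: rep_zero span_zero)
  next
    case (root_mat p q)
    show ?case
    proof (cases "p < n \<or> q < n")
      case True
      then obtain c where "\<rho> (root_mat n p q) v = scl c v" using v root_mat by blast
      then show ?thesis by (simp add: descendants.base span_base span_scale)
    next
      case False
      then show ?thesis using root_mat by (intro span_base descendants.step descendants.base) auto
    qed
  qed (simp_all add: rep_add rep_smult span_add span_scale)
  have "\<rho> X w \<in> span (descendants v)" if "w \<in> descendants v" "X \<in> sp n" for w X
    using that
  proof (induction arbitrary: X)
    case base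
    then show ?case using \<open>\<And>X. X \<in> sp n \<Longrightarrow> \<rho> X v \<in> span (descendants v)\<close> by blast
  next
    case (step w p q)
    let ?F = "root_mat n p q"
    have F: "?F \<in> sp n" using step.hyps by simp
    have "\<rho> (bracket X ?F) w = \<rho> X (\<rho> ?F w) - \<rho> ?F (\<rho> X w)"
      using F step.prems by (simp add: rep_bracket)
    then have "\<rho> X (\<rho> ?F w) = \<rho> (bracket X ?F) w + \<rho> ?F (\<rho> X w)" by simp
    moreover have "\<rho> (bracket X ?F) w \<in> span (descendants v)"
      using F step.prems by (intro step.IH) simp
    moreover have "\<rho> ?F (\<rho> X w) \<in> span (descendants v)"
      using F step.hyps
      by (intro rep_span_subset[OF F _ step.IH[OF step.prems]]) (auto intro!: span_base descendants.step)
    ultimately show ?case by (simp add: span_add)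
  qed
  then show ?thesis using rep_span_subset[OF X _ x] X by blast
qed

text \<open>Sums of vectors with weights in \<open>\<Lambda>\<close> exhaust the representation, and
  by independence none of them is a nonzero vector of another weight.\<close>

lemma weights_subset:
  assumes span: "span D = UNIV" and \<Lambda>: "\<Lambda> \<subseteq> carrier_vec n"
    and D: "\<And>w. w \<in> D \<Longrightarrow> \<exists>\<mu>\<in>\<Lambda>. w \<in> weight_space \<mu>"
  shows "weights \<subseteq> \<Lambda>"
proof
  fix m assume "m \<in> weights"
  then obtain x where x: "m \<in> carrier_vec n" "x \<in> weight_space m" "x \<noteq> 0" by (auto simp: weights_def)
  have "x \<in> span D" using span by simp
  \<comment> \<open>Here \<open>f\<close> is total and vanishes off \<open>S\<close>, so adding a
    vector of weight \<open>\<mu>\<close> is a single update, whether or not \<open>\<mu>\<close>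
    already occurs.\<close>
  then have "\<exists>S f. finite S \<and> S \<subseteq> \<Lambda> \<and> (\<forall>\<nu>. f \<nu> \<in> weight_space \<nu>) \<and> (\<forall>\<nu>. \<nu> \<notin> S \<longrightarrow> f \<nu> = 0) \<and> x = (\<Sum>\<nu>\<in>S. f \<nu>)"
  proof (induction rule: span_induct_alt)
    case base
    then show ?case by (intro exI[of _ "{}"] exI[of _ "\<lambda>_. 0"]) simp
  next
    case (step c w y)
    obtain \<mu> where \<mu>: "\<mu> \<in> \<Lambda>" "w \<in> weight_space \<mu>" using D step.hyps by blast
    obtain S f where S: "finite S" "S \<subseteq> \<Lambda>" "\<And>\<nu>. f \<nu> \<in> weight_space \<nu>" "\<And>\<nu>. \<nu> \<notin> S \<Longrightarrow> f \<nu> = 0" "y = (\<Sum>\<nu>\<in>S. f \<nu>)"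
      using step.IH by blast
    let ?g = "f(\<mu> := scl c w + f \<mu>)"
    have "y = (\<Sum>\<nu>\<in>insert \<mu> S. f \<nu>)" using S by (simp add: sum.insert_if)
    then have "y = f \<mu> + (\<Sum>\<nu>\<in>S - {\<mu>}. f \<nu>)" using S(1) by (simp add: sum.insert_remove)
    moreover have "(\<Sum>\<nu>\<in>insert \<mu> S. ?g \<nu>) = scl c w + f \<mu> + (\<Sum>\<nu>\<in>S - {\<mu>}. f \<nu>)"
      using S(1) by (simp add: sum.insert_remove)
    ultimately have "scl c w + y = (\<Sum>\<nu>\<in>insert \<mu> S. ?g \<nu>)" by (simp add: add.assoc)
    then show ?case
      using S \<mu> by (intro exI[of _ "insert \<mu> S"] exI[of _ ?g]) (auto intro: add_in_weight_space scale_in_weight_space)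
  qed
  then obtain S f where S: "finite S" "S \<subseteq> \<Lambda>" "\<And>\<nu>. f \<nu> \<in> weight_space \<nu>" "x = (\<Sum>\<nu>\<in>S. f \<nu>)"
    by blast
  show "m \<in> \<Lambda>"
  proof (rule ccontr)
    assume m: "m \<notin> \<Lambda>"
    \<comment> \<open>Placing \<open>- x\<close> at the foreign weight \<open>m\<close> turns the
      decomposition into a vanishing sum of weight vectors.\<close>
    define g where "g = f(m := - x)"
    have "(\<Sum>\<nu>\<in>S. g \<nu>) = x" unfolding S(4) g_def using m S(2) by (intro sum.cong) auto
    then have "(\<Sum>\<nu>\<in>insert m S. g \<nu>) = 0" using S(1,2) m by (subst sum.insert) (auto simp: g_def)
    then have "\<forall>\<nu>\<in>insert m S. g \<nu> = 0"
      using S x \<Lambda> minus_in_weight_space[OF x(2)] by (intro independent_weight_vectors) (auto simp: g_def)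
    then show False using x by (simp add: g_def)
  qed
qed

section \<open>Weights in the cube\<close>

text \<open>Descend along \<open>- 2 e_i\<close> to the end of the string. The ascending string from
  there ends at the negative of the lowest coordinate, and \<open>le\<close> bounds that by
  \<open>M\<close>.\<close>

lemma weights_ge:
  assumes le: "\<And>m i. m \<in> weights \<Longrightarrow> i < n \<Longrightarrow> m $ i \<le> int M" and m: "m \<in> weights" and i: "i < n"
  shows "- int M \<le> m $ i"
proof (rule ccontr)
  assume less: "\<not> - int M \<le> m $ i"
  obtain v where v: "m \<in> carrier_vec n" "v \<in> weight_space m" "v \<noteq> 0" using m by (auto simp: weights_def)
  define p where "p = opp n i"
  have p: "p < 2 * n" "p \<noteq> opp n p" "opp n p = i" using i by (auto simp: p_def)
  obtain r where r: "(\<rho> (root_mat n p p) ^^ r) v \<noteq> 0" "(\<rho> (root_mat n p p) ^^ Suc r) v = 0"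
    using root_mat_nilpotent[OF p(1,1,2) v] by blast
  define m' where "m' = m + int r \<cdot>\<^sub>v (wt n p + wt n p)"
  define u where "u = (\<rho> (root_mat n p p) ^^ r) v"
  have u: "m' \<in> carrier_vec n" "u \<in> weight_space m'" "u \<noteq> 0" "\<rho> (root_mat n p p) u = 0"
    using root_mat_funpow_weight_space[OF p(1,1) v(1,2)] r v(1) by (auto simp: m'_def u_def)
  obtain k where k: "pairing n m' p p = int k" "(\<rho> (root_mat n i i) ^^ k) u \<noteq> 0"
    using sl2_string[OF p(1,1,2) u] unfolding p(3) by blast
  have i2: "i < 2 * n" using i by simp
  have "m' + int k \<cdot>\<^sub>v (wt n i + wt n i) \<in> weights"
    using root_mat_funpow_weight_space[OF i2 i2 u(1,2), of k] k(2) u(1) by (auto simp: weights_def)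
  then have "(m' + int k \<cdot>\<^sub>v (wt n i + wt n i)) $ i \<le> int M" using le i by blast
  then have "m' $ i + 2 * int k \<le> int M" using i u(1) by (simp add: wt_def)
  moreover have "m' $ i = m $ i - 2 * int r" using i v(1) by (simp add: m'_def p_def opp_def wt_def)
  moreover have "int k = - (m' $ i)" using k(1) i by (simp add: pairing_def p_def opp_def ext_coord_def)
  ultimately show False using less by linarith
qed

text \<open>A coordinate attaining the bound makes the raising operator for \<open>2 e_i\<close>
  vanish, so the descending string has exactly \<open>M\<close> steps of size 2 and ends at
  \<open>- M\<close>.\<close>

lemma weights_flip:
  assumes le: "\<And>m i. m \<in> weights \<Longrightarrow> i < n \<Longrightarrow> m $ i \<le> int M" and m: "m \<in> weights" and i: "i < n"
    and mi: "m $ i = int M"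
  shows "m + int M \<cdot>\<^sub>v (wt n (opp n i) + wt n (opp n i)) \<in> weights"
proof -
  obtain v where v: "m \<in> carrier_vec n" "v \<in> weight_space m" "v \<noteq> 0" using m by (auto simp: weights_def)
  have i2: "i < 2 * n" "i \<noteq> opp n i" using i by auto
  have "\<rho> (root_mat n i i) v = 0"
  proof (rule ccontr)
    assume "\<rho> (root_mat n i i) v \<noteq> 0"
    then have "m + (wt n i + wt n i) \<in> weights"
      using root_mat_weight_space[OF i2(1,1) v(1,2)] v(1) by (auto simp: weights_def)
    then show False using le[of "m + (wt n i + wt n i)" i] i mi v(1) by (simp add: wt_def)
  qed
  then obtain k where k: "pairing n m i i = int k" "(\<rho> (root_mat n (opp n i) (opp n i)) ^^ k) v \<noteq> 0"
    using sl2_string[OF i2(1,1,2) v] by blast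
  have "k = M" using k(1) i mi by (simp add: pairing_def ext_coord_def)
  then show ?thesis
    using root_mat_funpow_weight_space[OF opp_less[OF i2(1)] opp_less[OF i2(1)] v(1,2), of k] k(2) v(1)
    by (auto simp: weights_def)
qed

lemma cube_vertex_in_weights:
  assumes le: "\<And>m i. m \<in> weights \<Longrightarrow> i < n \<Longrightarrow> m $ i \<le> int M"
    and top: "vec n (\<lambda>_. int M) \<in> weights" and "finite I" "I \<subseteq> {..<n}"
  shows "vec n (\<lambda>i. if i \<in> I then - int M else int M) \<in> weights"
  using assms(3,4)
proof (induction I)
  case empty
  then show ?case using top by simp
next
  case (insert j I)
  define m where "m = vec n (\<lambda>i. if i \<in> I then - int M else int M)"
  have j: "j < n" using insert by simp
  have "m + int M \<cdot>\<^sub>v (wt n (opp n j) + wt n (opp n j)) \<in> weights"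
    using insert by (intro weights_flip[OF le]) (auto simp: m_def)
  moreover have "m + int M \<cdot>\<^sub>v (wt n (opp n j) + wt n (opp n j)) = vec n (\<lambda>i. if i \<in> insert j I then - int M else int M)"
    using insert j by (intro eq_vecI) (auto simp: m_def wt_def opp_def)
  ultimately show ?case by simp
qed

text \<open>
  Starting from the vertex of the cube in the closed orthant of \<open>t\<close>, each step towards \<open>t\<close> is along a
  root pairing negatively with the current weight, so it does not leave the set of weights.
\<close>

lemma cube_subset_weights:
  assumes le: "\<And>m i. m \<in> weights \<Longrightarrow> i < n \<Longrightarrow> m $ i \<le> int M"
    and top: "vec n (\<lambda>_. int M) \<in> weights"
    and t: "t \<in> carrier_vec n" "\<And>i. i < n \<Longrightarrow> \<bar>t $ i\<bar> \<le> int M" "even (\<Sum>i<n. t $ i + int M)"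
  shows "t \<in> weights"
proof -
  define x where "x = vec n (\<lambda>i. if i \<in> {i. i < n \<and> t $ i < 0} then - int M else int M)"
  have xw: "x \<in> weights" unfolding x_def by (intro cube_vertex_in_weights le top) auto
  have xc: "x \<in> carrier_vec n" by (simp add: x_def)
  \<comment> \<open>Being below \<open>t\<close> in a signed direction means that the vertex has
    value \<open>- M\<close> there, so by the choice of signs \<open>t\<close> is not positive
    there.\<close>
  have xl: "\<forall>r<2*n. ext_coord n x r < ext_coord n t r \<longrightarrow> ext_coord n t r \<le> 0"
  proof (intro allI impI)
    fix r assume r: "r < 2 * n" "ext_coord n x r < ext_coord n t r"
    then show "ext_coord n t r \<le> 0"
      using t(2)[of r] t(2)[of "r - n"] by (auto simp: x_def ext_coord_def split: if_splits)
  qed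
  have "even ((\<Sum>i<n. t $ i + int M) + (\<Sum>i<n. (x - t) $ i))"
    unfolding sum.distrib[symmetric] using t(1) xc by (intro dvd_sum) (auto simp: x_def)
  then have "even (l1_norm (x - t))" using t by (simp add: even_l1_norm_iff)
  with xc t(1) have "t \<in> weights \<and> (\<forall>r<2*n. ext_coord n t r < ext_coord n t r \<longrightarrow> ext_coord n t r \<le> 0)"
  proof (induct rule: lattice_step_induct
      [where P = "\<lambda>x. x \<in> weights \<and> (\<forall>r<2*n. ext_coord n x r < ext_coord n t r \<longrightarrow> ext_coord n t r \<le> 0)"])
    case base
    then show ?case using xw xl by simp
  next
    case (step x p q)
    \<comment> \<open>By the invariant \<open>x\<close> lies strictly below a nonpositive value in
      both directions, so the root pairs negatively with it.\<close>
    have "ext_coord n x p < 0" "ext_coord n x q < 0"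
      using step(2,3,4,6,7) by fastforce+
    then have "x + (wt n p + wt n q) \<in> weights"
      using step(2,3,4,5) by (intro weights_step) (auto simp: pairing_def)
    moreover have "ext_coord n t r \<le> 0" if r: "r < 2 * n" "ext_coord n (x + (wt n p + wt n q)) r < ext_coord n t r" for r
    proof -
      \<comment> \<open>Read in the opposite direction, this bound says that the step creates no new
        direction in which the point is below \<open>t\<close>.\<close>
      have "ext_coord n (x + (wt n p + wt n q)) (opp n r) \<le> max (ext_coord n x (opp n r)) (ext_coord n t (opp n r))"
        using r by (intro step(9)) simp
      then have "ext_coord n x r < ext_coord n t r"
        using r by simp
      then show ?thesis using step(2) r by blast
    qed
    ultimately show ?case by blast
  qed
  then show ?thesis by blast
qed

lemma positive_root_vector_kills:
  assumes v: "\<And>\<alpha> X. \<alpha> \<in> positive_roots n \<Longrightarrow> X \<in> root_space n \<alpha> \<Longrightarrow> \<rho> X v = 0"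
    and p: "p < n" and q: "q < n \<or> (q < 2 * n \<and> p < q - n)"
  shows "\<rho> (root_mat n p q) v = 0"
proof -
  have q2: "q < 2 * n" using q by auto
  have "wt n p + wt n q \<in> positive_roots n"
  proof (cases "q < n")
    case True
    consider "p = q" | "p < q" | "q < p" by linarith
    then show ?thesis
    proof cases
      case 1
      have "wt n p + wt n q = 2 \<cdot>\<^sub>v unit_vec n p" using 1 p by (intro eq_vecI) (auto simp: wt_def)
      then show ?thesis using p by (auto simp: positive_roots_def)
    next
      case 2
      then show ?thesis using p True by (auto simp: positive_roots_def wt_def)
    next
      case 3
      then have "wt n p + wt n q = unit_vec n q + unit_vec n p"
        using p True by (intro eq_vecI) (auto simp: wt_def)
      then show ?thesis using p 3 by (auto simp: positive_roots_def)
    qed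
  next
    case False
    then have "wt n p + wt n q = unit_vec n p - unit_vec n (q - n)"
      using p q by (intro eq_vecI) (auto simp: wt_def)
    moreover have "p < q - n" "q - n < n" using q False by auto
    ultimately show ?thesis unfolding positive_roots_def by blast
  qed
  then show ?thesis using v root_mat_root_space[of p n q] p q2 by simp
qed

text \<open>Positive root vectors kill \<open>v\<close> and Cartan elements scale it. For a negative
  root of \<open>gl(n)\<close> the coroot takes the value \<open>M - M = 0\<close> on the highest
  weight, so the string has length zero.\<close>

lemma highest_weight_vector_root_mat:
  assumes v: "\<And>\<alpha> X. \<alpha> \<in> positive_roots n \<Longrightarrow> X \<in> root_space n \<alpha> \<Longrightarrow> \<rho> X v = 0"
    and top: "v \<in> weight_space (vec n (\<lambda>_. int M))" "v \<noteq> 0"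
    and p: "p < n" and q: "q < 2 * n"
  shows "\<exists>c. \<rho> (root_mat n p q) v = scl c v"
proof -
  consider "q < n \<or> (q < 2 * n \<and> p < q - n)" | "q = opp n p" | "n \<le> q" "q - n < p"
    using p q by (fastforce simp: opp_def)
  then show ?thesis
  proof cases
    case 1
    then show ?thesis using positive_root_vector_kills[OF v p] by (intro exI[of _ 0]) simp
  next
    case 2
    have "\<rho> (root_mat n p q) v = scl (- eps n p) (scl (functional n (vec n (\<lambda>_. int M)) (wt n p)) v)"
      using p weight_spaceD[OF top(1)] unfolding 2 by (simp add: root_mat_opp rep_smult)
    then show ?thesis unfolding scale_scale by blast
  next
    case 3
    \<comment> \<open>Passing to opposite indices makes \<open>wt n a + wt n b\<close> a positive
      root, so that its operator kills \<open>v\<close> as \<open>sl2_string\<close>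
      requires.\<close>
    define a b where "a = opp n p" and "b = opp n q"
    have ab: "a < 2 * n" "b < 2 * n" "b < n" "opp n a = p" "opp n b = q" "b \<noteq> opp n a" "b \<noteq> a"
      using p q 3 by (auto simp: a_def b_def) (auto simp: opp_def)
    have "\<rho> (root_mat n b a) v = 0"
      using p 3 ab(3) by (intro positive_root_vector_kills[OF v]) (auto simp: a_def b_def opp_def)
    then have "\<rho> (root_mat n a b) v = 0" by (simp add: root_mat_commute)
    then obtain k where k: "pairing n (vec n (\<lambda>_. int M)) a b = int k" "(\<rho> (root_mat n p q) ^^ Suc k) v = 0"
      using sl2_string[OF ab(1,2,6) _ top] unfolding ab(4,5) by auto
    have "k = 0" using k(1) p q ab(7) 3 by (auto simp: pairing_def a_def b_def) (auto simp: ext_coord_def)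
    then have "\<rho> (root_mat n p q) v = 0" using k(2) by simp
    then show ?thesis by (intro exI[of _ 0]) simp
  qed
qed

lemma weights_eq:
  assumes irr: irreducible_rep and hw: "has_highest_weight (vec n (\<lambda>_. int M))"
  shows "weights = {m \<in> carrier_vec n. (\<forall>i<n. \<bar>m $ i\<bar> \<le> int M) \<and> even (\<Sum>i<n. m $ i + int M)}"
proof -
  obtain v where v: "v \<in> weight_space (vec n (\<lambda>_. int M))" "v \<noteq> 0"
    and kill: "\<And>\<alpha> X. \<alpha> \<in> positive_roots n \<Longrightarrow> X \<in> root_space n \<alpha> \<Longrightarrow> \<rho> X v = 0"
    using hw by (auto simp: has_highest_weight_def)
  let ?W = "span (descendants v)"
  have "\<exists>c. \<rho> (root_mat n p q) v = scl c v" if "p < 2 * n" "q < 2 * n" "p < n \<or> q < n" for p q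
    using that highest_weight_vector_root_mat[OF kill v, where p = p and q = q] highest_weight_vector_root_mat[OF kill v, where p = q and q = p]
    by (auto simp: root_mat_commute[of n q p])
  then have "\<forall>X\<in>sp n. \<rho> X ` ?W \<subseteq> ?W" using span_descendants_invariant[of v] by blast
  moreover have "v \<in> ?W" by (intro span_base descendants.base)
  ultimately have "?W = {0} \<or> ?W = UNIV" and "?W \<noteq> {0}"
    using irr v(2) subspace_span[of "descendants v"] by (simp_all add: irreducible_rep_def) auto
  then have W: "?W = UNIV" by blast
  \<comment> \<open>Upper bounds and parity pass along descendants; the lower bounds follow
    afterwards from \<open>weights_ge\<close>.\<close>
  define \<Lambda> where "\<Lambda> = {m \<in> carrier_vec n. (\<forall>i<n. m $ i \<le> int M) \<and> even (\<Sum>i<n. m $ i + int M)}"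
  have "\<exists>\<mu>\<in>\<Lambda>. w \<in> weight_space \<mu>" if "w \<in> descendants v" for w
    using that
  proof induction
    case base
    then show ?case using v(1) by (intro bexI[of _ "vec n (\<lambda>_. int M)"]) (auto simp: \<Lambda>_def intro!: dvd_sum)
  next
    case (step w p q)
    then obtain \<mu> where \<mu>: "\<mu> \<in> \<Lambda>" "w \<in> weight_space \<mu>" by blast
    have \<mu>c: "\<mu> \<in> carrier_vec n" using \<mu> by (simp add: \<Lambda>_def)
    let ?\<nu> = "\<mu> + (wt n p + wt n q)"
    have "(\<Sum>i<n. ?\<nu> $ i + int M) = (\<Sum>i<n. \<mu> $ i + int M) + (eps n p + eps n q)"
      unfolding sum_wt[OF step.hyps(3), symmetric] sum_wt[OF step.hyps(5), symmetric] sum.distrib[symmetric]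
      using \<mu>c by (intro sum.cong) auto
    then have "even (\<Sum>i<n. ?\<nu> $ i + int M)"
      using \<mu>(1) step.hyps by (simp add: \<Lambda>_def eps_def)
    moreover have "?\<nu> $ i \<le> int M" if "i < n" for i
    proof -
      have "?\<nu> $ i \<le> \<mu> $ i" using step.hyps that \<mu>c by (auto simp: wt_def)
      also have "\<dots> \<le> int M" using \<mu>(1) that by (simp add: \<Lambda>_def)
      finally show ?thesis .
    qed
    moreover have "?\<nu> \<in> carrier_vec n" using \<mu>c by simp
    ultimately have "?\<nu> \<in> \<Lambda>" unfolding \<Lambda>_def by blast
    then show ?case using root_mat_weight_space[OF step.hyps(3,5) \<mu>c \<mu>(2)] by blast
  qed
  then have sub: "weights \<subseteq> \<Lambda>" by (intro weights_subset[OF W]) (auto simp: \<Lambda>_def)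
  then have le: "m $ i \<le> int M" if "m \<in> weights" "i < n" for m i
    using that by (auto simp: \<Lambda>_def)
  have top: "vec n (\<lambda>_. int M) \<in> weights" using v by (auto simp: weights_def)
  show ?thesis
  proof (intro equalityI subsetI)
    fix m assume m: "m \<in> weights"
    have "\<bar>m $ i\<bar> \<le> int M" if i: "i < n" for i
    proof -
      have "- int M \<le> m $ i" by (rule weights_ge[OF _ m i]) (rule le)
      then show ?thesis using le[OF m i] by linarith
    qed
    moreover have "m \<in> \<Lambda>" using sub m by (rule subsetD)
    ultimately show "m \<in> {m \<in> carrier_vec n. (\<forall>i<n. \<bar>m $ i\<bar> \<le> int M) \<and> even (\<Sum>i<n. m $ i + int M)}"
      unfolding \<Lambda>_def by simp
  next
    fix m assume "m \<in> {m \<in> carrier_vec n. (\<forall>i<n. \<bar>m $ i\<bar> \<le> int M) \<and> even (\<Sum>i<n. m $ i + int M)}"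
    then have "m \<in> carrier_vec n" "\<And>i. i < n \<Longrightarrow> \<bar>m $ i\<bar> \<le> int M" "even (\<Sum>i<n. m $ i + int M)"
      by auto
    then show "m \<in> weights" by (rule cube_subset_weights[OF _ top, rotated]) (assumption | rule le)+
  qed
qed

lemma weights_shift_eq:
  assumes irreducible_rep and "has_highest_weight (vec n (\<lambda>_. int M))"
  shows "(\<lambda>m. m + vec n (\<lambda>_. int M)) ` weights = lattice_points M n"
proof (intro equalityI subsetI)
  fix l assume "l \<in> (\<lambda>m. m + vec n (\<lambda>_. int M)) ` weights"
  then obtain m where m: "m \<in> weights" "l = m + vec n (\<lambda>_. int M)" by blast
  then have mc: "m \<in> carrier_vec n" and box: "\<And>i. i < n \<Longrightarrow> \<bar>m $ i\<bar> \<le> int M"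
    and ev: "even (\<Sum>i<n. m $ i + int M)"
    unfolding weights_eq[OF assms] by blast+
  have li: "l $ i = m $ i + int M" if "i < n" for i using that mc by (simp add: m)
  have "(\<Sum>i<n. l $ i) = (\<Sum>i<n. m $ i + int M)" by (intro sum.cong) (simp_all add: li)
  moreover have "0 \<le> l $ i \<and> l $ i \<le> 2 * int M" if "i < n" for i
    using box[OF that] li[OF that] by linarith
  moreover have "l \<in> carrier_vec n" using mc by (simp add: m)
  ultimately show "l \<in> lattice_points M n" unfolding lattice_points_def using ev by simp
next
  fix l assume l: "l \<in> lattice_points M n"
  then have lc: "l \<in> carrier_vec n" and box: "\<And>i. i < n \<Longrightarrow> 0 \<le> l $ i \<and> l $ i \<le> 2 * int M"
    and ev: "even (\<Sum>i<n. l $ i)"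
    unfolding lattice_points_def by blast+
  define m where "m = l - vec n (\<lambda>_. int M)"
  have mi: "m $ i = l $ i - int M" if "i < n" for i using that lc by (simp add: m_def)
  have "(\<Sum>i<n. m $ i + int M) = (\<Sum>i<n. l $ i)" by (intro sum.cong) (simp_all add: mi)
  moreover have "\<bar>m $ i\<bar> \<le> int M" if "i < n" for i
    using box[OF that] mi[OF that] by linarith
  moreover have "m \<in> carrier_vec n" using lc by (simp add: m_def)
  ultimately have "m \<in> weights" unfolding weights_eq[OF assms] using ev by simp
  moreover have "l = m + vec n (\<lambda>_. int M)"
    using lc by (intro eq_vecI) (simp_all add: m_def)
  ultimately show "l \<in> (\<lambda>m. m + vec n (\<lambda>_. int M)) ` weights" by blast
qed

end

text \<open>The first two conjuncts confirm that the edges and vertices in the encoding of the graph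
  are the intended ones.\<close>

theorem theorem3:
  fixes M n :: nat
    and scl :: "complex \<Rightarrow> 'v::ab_group_add \<Rightarrow> 'v"
    and \<rho> :: "complex mat \<Rightarrow> 'v \<Rightarrow> 'v"
  assumes "M \<ge> 1" and "n \<ge> 1"
  shows "roots n =
           {2 \<cdot>\<^sub>v unit_vec n i | i. i < n}
           \<union> {- (2 \<cdot>\<^sub>v unit_vec n i) | i. i < n}
           \<union> {unit_vec n i + unit_vec n j | i j. i < n \<and> j < n \<and> i \<noteq> j}
           \<union> {unit_vec n i - unit_vec n j | i j. i < n \<and> j < n \<and> i \<noteq> j}
           \<union> {- unit_vec n i + unit_vec n j | i j. i < n \<and> j < n \<and> i \<noteq> j}
           \<union> {- unit_vec n i - unit_vec n j | i j. i < n \<and> j < n \<and> i \<noteq> j}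
       \<and> (sp_representation n scl \<rho>
            \<and> sp_representation.irreducible_rep n scl \<rho>
            \<and> sp_representation.has_highest_weight n scl \<rho> (vec n (\<lambda>_. int M))
          \<longrightarrow> (\<lambda>m. m + vec n (\<lambda>_. int M)) ` sp_representation.weights n scl \<rho>
              = verts (symplectic_lattice M n))
       \<and> (\<forall>l \<in> verts (symplectic_lattice M n). \<forall>l' \<in> verts (symplectic_lattice M n).
            graph_distance (symplectic_lattice M n) l l'
              = ereal (\<Sum>i<n. real_of_int \<bar>l $ i - l' $ i\<bar> / 2))"
proof (intro conjI impI ballI)
  assume rep: "sp_representation n scl \<rho>
      \<and> sp_representation.irreducible_rep n scl \<rho>
      \<and> sp_representation.has_highest_weight n scl \<rho> (vec n (\<lambda>_. int M))"
  then interpret sp_representation n scl \<rho> by blast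
  show "(\<lambda>m. m + vec n (\<lambda>_. int M)) ` weights = verts (symplectic_lattice M n)"
    using weights_shift_eq rep by (simp add: symplectic_lattice_def)
next
  fix l l' assume ll: "l \<in> verts (symplectic_lattice M n)" "l' \<in> verts (symplectic_lattice M n)"
  then have "l \<in> carrier_vec n" "l' \<in> carrier_vec n"
    by (auto simp: symplectic_lattice_def lattice_points_def)
  then have "real_of_int (l1_norm (l - l')) / 2 = (\<Sum>i<n. real_of_int \<bar>l $ i - l' $ i\<bar> / 2)"
    by (simp add: l1_norm_def sum_divide_distrib)
  then show "graph_distance (symplectic_lattice M n) l l' = ereal (\<Sum>i<n. real_of_int \<bar>l $ i - l' $ i\<bar> / 2)"
    using ll graph_distance_symplectic_lattice[of l M n l'] by (simp add: symplectic_lattice_def)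
qed (rule roots_eq)

end
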